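(* Let $D=(V,A)$ be a digraph, let $b \in \mathbb{Z}_{++}^V$, and let $\ell$ be a nonnegative integer. Then the convex hull of the incidence vectors (in $\mathbb{R}^A$) of the $b$-branchings in $D$ of size $\ell$ has the integer decomposition property.
   Context: $\mathbb{Z}_{++}$ denotes the positive integers. For a digraph $D=(V,A)$, $F \subseteq A$ and $v \in V$, $d^-_F(v)$ is the number of arcs of $F$ with head $v$. For $X \subseteq V$, $b(X)=\sum_{v \in X} b(v)$ and $F[X]$ is the set of arcs of $F$ with both ends in $X$. An arc set $B \subseteq A$ is a $b$-branching if $d^-_B(v) \le b(v)$ for every $v \in V$ and $|B[X]| \le b(X)-1$ for every nonempty $X \subseteq V$. For a polytope $P$ and positive integer $\kappa$, $\kappa P=\{\kappa x' \mid x' \in P\}$. A polytope $P$ has the integer decomposition property if for every positive integer $\kappa$ and every integer vector $x \in \kappa P$ there exist $\kappa$ integer vectors $x_1,\ldots,x_\kappa \in P$ with $x = x_1+\cdots+x_\kappa$. *)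

theory Defs
  imports "HOL-Analysis.Analysis" "Graph_Theory.Digraph"
begin

text \<open>
  Vectors in \<open>\<real>\<^sup>A\<close> are rendered as elements of \<^typ>\<open>real ^ 'e\<close>, where the finite type \<open>'e\<close>
  contains the arc set \<open>A = arcs G\<close>. The arc set may be a proper (possibly empty) subset of
  \<open>'e\<close>; coordinates outside of it vanish on all incidence vectors of arc sets, hence on their
  convex hull and its dilations, which therefore lie in the coordinate subspace \<open>\<real>\<^sup>A\<close>.
\<close>

definition arcs_within :: "('v, 'e) pre_digraph \<Rightarrow> 'e set \<Rightarrow> 'v set \<Rightarrow> 'e set" where
  "arcs_within G F X = {a \<in> F. tail G a \<in> X \<and> head G a \<in> X}"

definition in_degree_of :: "('v, 'e) pre_digraph \<Rightarrow> 'e set \<Rightarrow> 'v \<Rightarrow> nat" where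
  "in_degree_of G F v = card {a \<in> F. head G a = v}"

text \<open>The bounds are stated over \<^typ>\<open>int\<close> to avoid truncated subtraction.\<close>

definition b_branching :: "('v, 'e) pre_digraph \<Rightarrow> ('v \<Rightarrow> int) \<Rightarrow> 'e set \<Rightarrow> bool" where
  "b_branching G b B \<longleftrightarrow>
     B \<subseteq> arcs G \<and>
     (\<forall>v\<in>verts G. int (in_degree_of G B v) \<le> b v) \<and>
     (\<forall>X. X \<subseteq> verts G \<and> X \<noteq> {} \<longrightarrow> int (card (arcs_within G B X)) \<le> (\<Sum>v\<in>X. b v) - 1)"

definition incidence_vector :: "'e set \<Rightarrow> real ^ 'e" where
  "incidence_vector B = (\<chi> a. indicator B a)"

definition integral_vector :: "real ^ 'e \<Rightarrow> bool" where
  "integral_vector x \<longleftrightarrow> (\<forall>a. x $ a \<in> \<int>)"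

definition integer_decomposition_property :: "(real ^ 'e) set \<Rightarrow> bool" where
  "integer_decomposition_property P \<longleftrightarrow>
     (\<forall>\<kappa>::nat. \<kappa> > 0 \<longrightarrow>
       (\<forall>x. integral_vector x \<and> x \<in> (\<lambda>x'. real \<kappa> *\<^sub>R x') ` P \<longrightarrow>
         (\<exists>y :: nat \<Rightarrow> real ^ 'e.
           (\<forall>i\<in>{1..\<kappa>}. integral_vector (y i) \<and> y i \<in> P) \<and> x = (\<Sum>i=1..\<kappa>. y i))))"

end

(* The deficits s(v) = k b(v) - x(in-arcs of v) of an integer vector x in the k-th dilation are turned
   into s(v) arcs from a new root r. The constraints of the polytope become the cut condition of
   Edmonds' theorem on disjoint arborescences, so k disjoint spanning r-arborescences exist, and the
   remaining arcs can be distributed locally at every vertex, with parallel copies going to different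
   classes; deleting r leaves k b-branchings with sum x. A decomposition that minimizes the sum of the
   squared sizes consists of b-branchings of equal size, since two b-branchings can always be
   re-partitioned into two whose sizes differ by at most one. *)

theory Submission
  imports Defs
begin

section \<open>Packing branchings with prescribed root sets\<close>

text \<open>The in-degrees of an arc set B summed over X equal |B[X]| plus the number of arcs of B
  entering X. So when all in-degrees are at most b, B is a b-branching exactly if some arc of B
  enters every nonempty X whose vertices all have in-degree b(v). A branching inside B that is
  rooted at the vertices of smaller in-degree guarantees this, and packing such branchings is
  governed by cuts. The obstacle is the size of the classes. With the extra root, all other vertices
  have full in-degree in every class; how the root arcs are shared out, and hence the sizes after
  deleting the root, is left to the packing. Controlling sizes means prescribing in-degrees in the
  original digraph, where X must be entered at least as often as there are classes full on X. For
  two classes a suitable rounding of the halved in-degrees achieves this, which is why sizes are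
  evened out pairwise.\<close>

definition entering :: "('v, 'e) pre_digraph \<Rightarrow> 'v set \<Rightarrow> 'e set" where
  "entering G X = {a \<in> arcs G. head G a \<in> X \<and> tail G a \<notin> X}"

text \<open>The object is a spanning forest of arborescences with root set \<open>R\<close>.
  Reachability is encoded by cuts instead of paths: a cycle of \<open>T\<close> would avoid
  \<open>R\<close>, and no arc of \<open>T\<close> would enter its vertex set, since each vertex is
  the head of at most one.\<close>

definition spanning_branching :: "('v, 'e) pre_digraph \<Rightarrow> 'v set \<Rightarrow> 'e set \<Rightarrow> bool" where
  "spanning_branching G R T \<longleftrightarrow> T \<subseteq> arcs G \<and> inj_on (head G) T \<and> head G ` T = verts G - R \<and>
     (\<forall>X\<subseteq>verts G. X \<noteq> {} \<and> X \<inter> R = {} \<longrightarrow> T \<inter> entering G X \<noteq> {})"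

context fin_digraph
begin

lemma finite_entering [simp]: "finite (entering G X)"
  by (simp add: entering_def)

lemma sum_entering_eq: "sum c (entering G X) = (\<Sum>a\<in>arcs G. if a \<in> entering G X then c a else 0)"
  by (subst sum.inter_restrict[symmetric]) (auto simp: entering_def intro!: sum.cong)

lemma cut_submodular:
  fixes c :: "'b \<Rightarrow> nat"
  shows "sum c (entering G (X \<inter> Y)) + sum c (entering G (X \<union> Y))
       \<le> sum c (entering G X) + sum c (entering G Y)"
  unfolding sum_entering_eq sum.distrib[symmetric]
  by (rule sum_mono) (auto simp: entering_def)

lemma cut_decrement:
  fixes c :: "'b \<Rightarrow> nat"
  assumes "c a > 0"
  shows "sum (c(a := c a - 1)) (entering G X) + of_bool (a \<in> entering G X) = sum c (entering G X)"
proof (cases "a \<in> entering G X")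
  case True
  then show ?thesis
    using assms sum.cong[of "entering G X - {a}" _ "c(a := c a - 1)" c]
    by (auto simp: sum.remove[of "entering G X" a])
next
  case False
  then have "sum (c(a := c a - 1)) (entering G X) = sum c (entering G X)"
    by (intro sum.cong) auto
  with False show ?thesis by simp
qed

text \<open>Lovasz's argument: a minimal set that is tight for \<open>p\<close> and not contained in \<open>U\<close> contains
  an arc leaving \<open>U\<close> that can be removed without violating the cut condition.\<close>

lemma growing_arc_exists:
  fixes c :: "'b \<Rightarrow> nat" and p :: "'a set \<Rightarrow> nat"
  assumes anti: "antimono p"
    and superm: "\<forall>X Y. p X + p Y \<le> p (X \<inter> Y) + p (X \<union> Y)"
    and U: "U \<subset> verts G"
    and cut: "\<forall>X\<subseteq>verts G. X \<noteq> {} \<longrightarrow>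
        p X + of_bool (X \<inter> U = {}) \<le> sum c (entering G X)"
  shows "\<exists>a\<in>arcs G. c a > 0 \<and> tail G a \<in> U \<and> head G a \<notin> U \<and>
    (\<forall>X\<subseteq>verts G. sum c (entering G X) = p X \<longrightarrow> a \<notin> entering G X)"
proof (cases "\<exists>X. X \<subseteq> verts G \<and> sum c (entering G X) = p X \<and> X - U \<noteq> {}")
  case False
  \<comment> \<open>When all tight sets lie in \<open>U\<close>, an arc leaving \<open>U\<close>
    enters none of them, so any such arc with a copy left will do.\<close>
  have "verts G - U \<noteq> {}" "(verts G - U) \<inter> U = {}" using U by auto
  then have "0 < sum c (entering G (verts G - U))"
    using cut[rule_format, of "verts G - U"] by simp
  then obtain a where a: "a \<in> entering G (verts G - U)" "c a > 0"
    by (metis gr_zeroI less_irrefl sum.neutral)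
  show ?thesis
  proof (intro bexI[of _ a] conjI)
    show "\<forall>X\<subseteq>verts G. sum c (entering G X) = p X \<longrightarrow> a \<notin> entering G X"
      using False a by (auto simp: entering_def)
  qed (use a in \<open>auto simp: entering_def\<close>)
next
  case True
  let ?P = "\<lambda>X. X \<subseteq> verts G \<and> sum c (entering G X) = p X \<and> X - U \<noteq> {}"
  obtain X where X: "?P X" and min: "\<And>Y. ?P Y \<Longrightarrow> card X \<le> card Y"
    using ex_has_least_nat[of ?P _ card] True by metis
  \<comment> \<open>\<open>X\<close> is tight, while \<open>X - U\<close> avoids \<open>U\<close>
    and demands one unit more. So some arc with a copy left enters \<open>X - U\<close> but not
    \<open>X\<close>, which places its tail in \<open>X \<inter> U\<close>.\<close>
  have "sum c (entering G X) < sum c (entering G (X - U))"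
  proof -
    have "p X \<le> p (X - U)" by (rule antimonoD[OF anti]) auto
    moreover have "p (X - U) + of_bool ((X - U) \<inter> U = {}) \<le> sum c (entering G (X - U))"
      using X by (intro cut[rule_format]) auto
    moreover have "(X - U) \<inter> U = {}" by auto
    ultimately show ?thesis using X by simp
  qed
  moreover have "sum c (entering G (X - U)) \<le> sum c (entering G X)"
    if "\<forall>a\<in>entering G (X - U). c a > 0 \<longrightarrow> a \<in> entering G X"
    unfolding sum_entering_eq using that by (intro sum_mono) auto
  ultimately obtain a where a: "a \<in> entering G (X - U)" "c a > 0" "a \<notin> entering G X"
    using not_le by blast
  then have tU: "tail G a \<in> X \<inter> U" and hU: "head G a \<in> X - U" and aA: "a \<in> arcs G"
    by (auto simp: entering_def)
  show ?thesis
  proof (intro bexI[of _ a] conjI allI impI notI)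
    fix Y assume Y: "Y \<subseteq> verts G" "sum c (entering G Y) = p Y"
    assume "a \<in> entering G Y"
    then have aY: "head G a \<in> Y" "tail G a \<notin> Y" by (auto simp: entering_def)
    have "p (X \<inter> Y) \<le> sum c (entering G (X \<inter> Y))" "p (X \<union> Y) \<le> sum c (entering G (X \<union> Y))"
      by (rule add_leD1, rule cut[rule_format]; use X Y aY hU in blast)+
    \<comment> \<open>Uncrossing: submodular cuts against a supermodular demand make
      \<open>X \<inter> Y\<close> tight as well. It contains the head of \<open>a\<close>, which is
      outside \<open>U\<close>, but not the tail, so it would be a smaller choice than
      \<open>X\<close>.\<close>
    then have "sum c (entering G (X \<inter> Y)) = p (X \<inter> Y)"
      using cut_submodular[of c X Y] superm[rule_format, of X Y] X Y by linarith
    then have "card X \<le> card (X \<inter> Y)"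
      using min[of "X \<inter> Y"] X aY hU by auto
    moreover have "finite X" using X finite_subset by fastforce
    ultimately have "X \<inter> Y = X" by (intro card_seteq) auto
    then show False using tU aY by auto
  qed (use a aA tU hU in auto)
qed

text \<open>Spending a copy of \<open>a\<close> lowers only the cuts that \<open>a\<close> enters.
  Such an \<open>X\<close> contains the head of \<open>a\<close>, so the extra unit is no longer
  demanded there, and it is not tight for \<open>p\<close>, so it has one unit to spare.\<close>

lemma growing_step:
  fixes c :: "'b \<Rightarrow> nat" and p :: "'a set \<Rightarrow> nat"
  assumes anti: "antimono p"
    and superm: "\<forall>X Y. p X + p Y \<le> p (X \<inter> Y) + p (X \<union> Y)"
    and U: "U \<subset> verts G"
    and cut: "\<forall>X\<subseteq>verts G. X \<noteq> {} \<longrightarrow> p X + of_bool (X \<inter> U = {}) \<le> sum c (entering G X)"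
  shows "\<exists>a\<in>arcs G. c a > 0 \<and> tail G a \<in> U \<and> head G a \<notin> U \<and>
    (\<forall>X\<subseteq>verts G. X \<noteq> {} \<longrightarrow>
      p X + of_bool (X \<inter> insert (head G a) U = {}) \<le> sum (c(a := c a - 1)) (entering G X))"
proof -
  obtain a where a: "a \<in> arcs G" "c a > 0" "tail G a \<in> U" "head G a \<notin> U"
    and tight: "\<forall>X\<subseteq>verts G. sum c (entering G X) = p X \<longrightarrow> a \<notin> entering G X"
    using growing_arc_exists[OF assms] by (elim bexE conjE) (rule that)
  have "p X + of_bool (X \<inter> insert (head G a) U = {}) \<le> sum (c(a := c a - 1)) (entering G X)"
    if X: "X \<subseteq> verts G" "X \<noteq> {}" for X
  proof -
    have dec: "sum (c(a := c a - 1)) (entering G X) + of_bool (a \<in> entering G X) = sum c (entering G X)"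
      by (rule cut_decrement) (rule a(2))
    have le: "p X + of_bool (X \<inter> U = {}) \<le> sum c (entering G X)"
      by (rule cut[rule_format, OF X])
    show ?thesis
    proof (cases "a \<in> entering G X")
      case True
      then have "of_bool (a \<in> entering G X) = (1::nat)"
        "of_bool (X \<inter> insert (head G a) U = {}) = (0::nat)" by (auto simp: entering_def)
      moreover have "p X \<noteq> sum c (entering G X)" using tight[rule_format, OF X(1)] True by metis
      ultimately show ?thesis using le dec by linarith
    next
      case False
      then have "of_bool (a \<in> entering G X) = (0::nat)" by simp
      moreover have "of_bool (X \<inter> insert (head G a) U = {}) \<le> (of_bool (X \<inter> U = {}) :: nat)"
        by auto
      ultimately show ?thesis using le dec by linarith
    qed
  qed
  then show ?thesis using a by (intro bexI[of _ a] conjI allI impI)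
qed

lemma spanning_branching_insert:
  assumes T: "spanning_branching G (insert (head G a) U) T"
    and a: "a \<in> arcs G" "tail G a \<in> U" "head G a \<notin> U"
  shows "spanning_branching G U (insert a T)"
  unfolding spanning_branching_def
proof (intro conjI allI impI)
  have "a \<notin> T" using T by (auto simp: spanning_branching_def)
  then show "insert a T \<subseteq> arcs G" "inj_on (head G) (insert a T)" "head G ` insert a T = verts G - U"
    using a T by (auto simp: spanning_branching_def)
next
  fix X assume X: "X \<subseteq> verts G" "X \<noteq> {} \<and> X \<inter> U = {}"
  show "insert a T \<inter> entering G X \<noteq> {}"
  proof (cases "head G a \<in> X")
    case True
    then have "a \<in> entering G X" using a X by (auto simp: entering_def)
    then show ?thesis by auto
  next
    case False
    then have "X \<inter> insert (head G a) U = {}" using X by auto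
    then have "T \<inter> entering G X \<noteq> {}" using T X by (simp add: spanning_branching_def)
    then show ?thesis by auto
  qed
qed

text \<open>Induction on the vertices not yet reached: after adding an arc, the enlarged set serves
  as the root set for the rest of the branching. The term \<open>of_bool (X \<inter> U = {})\<close>
  is the demand of the branching under construction, \<open>p\<close> the demand of those still to
  come.\<close>

lemma spanning_branching_exists:
  fixes c :: "'b \<Rightarrow> nat" and p :: "'a set \<Rightarrow> nat"
  assumes anti: "antimono p"
    and superm: "\<forall>X Y. p X + p Y \<le> p (X \<inter> Y) + p (X \<union> Y)"
    and "U \<subseteq> verts G"
    and "\<forall>X\<subseteq>verts G. X \<noteq> {} \<longrightarrow> p X + of_bool (X \<inter> U = {}) \<le> sum c (entering G X)"
  shows "\<exists>T. spanning_branching G U T \<and> (\<forall>a\<in>T. c a > 0) \<and>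
     (\<forall>X\<subseteq>verts G. X \<noteq> {} \<longrightarrow> p X \<le> sum (\<lambda>a. c a - of_bool (a \<in> T)) (entering G X))"
  using assms(3,4)
proof (induction "card (verts G - U)" arbitrary: U c rule: less_induct)
  case less
  show ?case
  proof (cases "U = verts G")
    case True
    have "p X \<le> sum c (entering G X)" if "X \<subseteq> verts G" "X \<noteq> {}" for X
      using less.prems(2)[rule_format, OF that] by (rule add_leD1)
    then have "\<forall>X\<subseteq>verts G. X \<noteq> {} \<longrightarrow> p X \<le> sum (\<lambda>a. c a - of_bool (a \<in> {})) (entering G X)"
      by simp
    moreover have "spanning_branching G U {}"
      using True by (auto simp: spanning_branching_def)
    ultimately show ?thesis by (intro exI[of _ "{}"]) simp
  next
    case False
    with less.prems(1) have U: "U \<subset> verts G" by auto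
    obtain a where a: "a \<in> arcs G" "c a > 0" "tail G a \<in> U" "head G a \<notin> U"
      and cut: "\<forall>X\<subseteq>verts G. X \<noteq> {} \<longrightarrow>
        p X + of_bool (X \<inter> insert (head G a) U = {}) \<le> sum (c(a := c a - 1)) (entering G X)"
      using growing_step[OF anti superm U less.prems(2)] by (elim bexE conjE) (rule that)
    let ?c = "c(a := c a - 1)" and ?U = "insert (head G a) U"
    have "head G a \<in> verts G" using a(1) by (rule head_in_verts)
    then have "verts G - ?U \<subset> verts G - U" "?U \<subseteq> verts G" using a(4) less.prems(1) by auto
    then have "\<exists>T. spanning_branching G ?U T \<and> (\<forall>a\<in>T. ?c a > 0) \<and>
     (\<forall>X\<subseteq>verts G. X \<noteq> {} \<longrightarrow> p X \<le> sum (\<lambda>a. ?c a - of_bool (a \<in> T)) (entering G X))"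
      by (intro less.hyps[OF _ _ cut] psubset_card_mono) (rule finite_Diff, rule finite_verts)
    then obtain T where T: "spanning_branching G ?U T" and pos: "\<forall>a\<in>T. ?c a > 0"
      and cut: "\<forall>X\<subseteq>verts G. X \<noteq> {} \<longrightarrow> p X \<le> sum (\<lambda>a. ?c a - of_bool (a \<in> T)) (entering G X)"
      by (elim exE conjE) (rule that)
    have "a \<notin> T" using T by (auto simp: spanning_branching_def)
    then have eq: "?c b - of_bool (b \<in> T) = c b - of_bool (b \<in> insert a T)" for b
      by auto
    have "\<forall>a\<in>insert a T. 0 < c a" using a(2) pos by (auto split: if_splits)
    then show ?thesis
      using spanning_branching_insert[OF T a(1,3,4)] cut[unfolded eq]
      by (intro exI[of _ "insert a T"] conjI)
  qed
qed

text \<open>Edmonds' theorem on disjoint branchings, with \<open>c\<close> counting parallel copies.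
  Each index whose roots miss \<open>X\<close> needs its own copy entering \<open>X\<close>. The
  demand \<open>p\<close> of the remaining indices is antimonotone and supermodular because each
  single indicator \<open>of_bool (R i \<inter> X = {})\<close> is, which allows one branching to be
  split off at a time.\<close>

theorem branching_packing:
  fixes c :: "'b \<Rightarrow> nat" and R :: "'i \<Rightarrow> 'a set"
  assumes "finite I"
    and "\<forall>i\<in>I. R i \<subseteq> verts G"
    and "\<forall>X\<subseteq>verts G. X \<noteq> {} \<longrightarrow> card {i\<in>I. R i \<inter> X = {}} \<le> sum c (entering G X)"
  shows "\<exists>T. (\<forall>i\<in>I. spanning_branching G (R i) (T i)) \<and>
      (\<forall>a\<in>arcs G. card {i\<in>I. a \<in> T i} \<le> c a)"
  using assms
proof (induction I arbitrary: c rule: finite_induct)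
  case empty
  then show ?case by simp
next
  case (insert j I)
  define p where "p = (\<lambda>X. card {i\<in>I. R i \<inter> X = {}})"
  have p_sum: "p X = (\<Sum>i\<in>I. of_bool (R i \<inter> X = {}))" for X
    using insert.hyps(1) by (simp add: p_def Int_def)
  have anti: "antimono p"
    unfolding p_def using insert.hyps(1) by (intro antimonoI card_mono) auto
  have superm: "\<forall>X Y. p X + p Y \<le> p (X \<inter> Y) + p (X \<union> Y)"
    unfolding p_sum sum.distrib[symmetric] by (intro allI sum_mono) auto
  have "p X + of_bool (X \<inter> R j = {}) = card {i\<in>insert j I. R i \<inter> X = {}}" for X
  proof -
    have "{i\<in>insert j I. R i \<inter> X = {}} = (if R j \<inter> X = {} then {j} else {}) \<union> {i\<in>I. R i \<inter> X = {}}"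
      by auto
    then show ?thesis using insert.hyps by (auto simp: p_def Int_commute)
  qed
  then have cut: "\<forall>X\<subseteq>verts G. X \<noteq> {} \<longrightarrow> p X + of_bool (X \<inter> R j = {}) \<le> sum c (entering G X)"
    using insert.prems(2) by simp
  obtain S where S: "spanning_branching G (R j) S" "\<forall>a\<in>S. c a > 0"
    "\<forall>X\<subseteq>verts G. X \<noteq> {} \<longrightarrow> p X \<le> sum (\<lambda>a. c a - of_bool (a \<in> S)) (entering G X)"
    using spanning_branching_exists[OF anti superm insert.prems(1)[rule_format, OF insertI1] cut]
    by (elim exE conjE) (rule that)
  obtain T where T: "\<forall>i\<in>I. spanning_branching G (R i) (T i)"
      "\<forall>a\<in>arcs G. card {i\<in>I. a \<in> T i} \<le> c a - of_bool (a \<in> S)"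
    using insert.IH[OF _ S(3)[unfolded p_def]] insert.prems(1) by auto
  have "card {i\<in>insert j I. a \<in> (T(j := S)) i} \<le> c a" if "a \<in> arcs G" for a
  proof -
    have "{i\<in>insert j I. a \<in> (T(j := S)) i} = (if a \<in> S then {j} else {}) \<union> {i\<in>I. a \<in> T i}"
      using insert.hyps by auto
    moreover have "card \<dots> \<le> of_bool (a \<in> S) + card {i\<in>I. a \<in> T i}"
      by (rule card_Un_le[THEN order_trans]) auto
    ultimately show ?thesis using T(2)[rule_format, OF that] S(2)
      by (cases "a \<in> S") fastforce+
  qed
  moreover have "\<forall>i\<in>insert j I. spanning_branching G (R i) ((T(j := S)) i)"
    using T(1) S(1) insert.hyps(2) by simp
  ultimately show ?case by (intro exI[of _ "T(j := S)"]) simp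
qed

end

section \<open>Packing b-branchings with prescribed in-degrees\<close>

lemma sum_card_fibers:
  assumes "finite I" "finite A" "\<And>i. i \<in> I \<Longrightarrow> F i \<subseteq> A"
  shows "(\<Sum>a\<in>A. card {i\<in>I. a \<in> F i}) = (\<Sum>i\<in>I. card (F i))"
proof -
  have "(\<Sum>a\<in>A. card {i\<in>I. a \<in> F i}) = (\<Sum>a\<in>A. \<Sum>i\<in>I. of_bool (a \<in> F i))"
    using assms(1) by (simp add: Int_def)
  also have "\<dots> = (\<Sum>i\<in>I. \<Sum>a\<in>A. of_bool (a \<in> F i))" by (rule sum.swap)
  also have "\<dots> = (\<Sum>i\<in>I. card (F i))"
    using assms(2,3) by (intro sum.cong) (auto intro!: arg_cong[where f = card])
  finally show ?thesis .
qed

lemma card_insert_filter: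
  assumes "finite I" "j \<notin> I"
  shows "card {i\<in>insert j I. P i} = of_bool (P j) + card {i\<in>I. P i}"
proof -
  have "{i\<in>insert j I. P i} = (if P j then {j} else {}) \<union> {i\<in>I. P i}" by auto
  then show ?thesis using assms by auto
qed

text \<open>The columns \<open>C i\<close> are filled one at a time, each using all rows \<open>a\<close> that have no slack left and
  only rows whose \<open>x a\<close> copies are not all reserved by the preset entries of later columns.\<close>

lemma balanced_assignment:
  fixes x :: "'a \<Rightarrow> nat" and \<beta> :: "'i \<Rightarrow> nat" and F :: "'i \<Rightarrow> 'a set"
  assumes "finite I" "finite A"
    and "\<forall>a\<in>A. x a \<le> card I"
    and "sum x A = sum \<beta> I"
    and "\<forall>i\<in>I. \<forall>j\<in>I. \<beta> i \<le> \<beta> j + 1"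
    and "\<forall>i\<in>I. F i \<subseteq> A \<and> card (F i) \<le> 1 \<and> (F i \<noteq> {} \<longrightarrow> (\<forall>j\<in>I. \<beta> j \<le> \<beta> i))"
    and "\<forall>a\<in>A. card {i\<in>I. a \<in> F i} \<le> x a"
  shows "\<exists>C. (\<forall>i\<in>I. F i \<subseteq> C i \<and> C i \<subseteq> A \<and> card (C i) = \<beta> i) \<and>
    (\<forall>a\<in>A. card {i\<in>I. a \<in> C i} = x a)"
  using assms(1,3-)
proof (induction I arbitrary: x rule: finite_induct)
  case empty
  then show ?case by auto
next
  case (insert j I)
  define n where "n a = card {i\<in>I. a \<in> F i}" for a
  define full where "full = {a\<in>A. x a = Suc (card I)}"
  define avail where "avail = {a\<in>A. n a < x a}"
  note fin = \<open>finite A\<close> \<open>finite I\<close>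
  have fin': "finite full" "finite avail" using fin by (auto simp: full_def avail_def)
  have x_le: "x a \<le> Suc (card I)" if "a \<in> A" for a
    using insert.prems(1) insert.hyps that by simp
  have sum_x: "sum x A = \<beta> j + sum \<beta> I" using insert.prems(2) insert.hyps by simp
  have bal: "\<beta> i \<le> \<beta> j + 1" "\<beta> j \<le> \<beta> i + 1" if "i \<in> I" for i
    using insert.prems(3) that by blast+
  have Fj: "F j \<subseteq> A" "card (F j) \<le> 1" "F j \<noteq> {} \<Longrightarrow> \<forall>i\<in>I. \<beta> i \<le> \<beta> j"
    and F: "\<And>i. i \<in> I \<Longrightarrow> F i \<subseteq> A" "\<And>i. i \<in> I \<Longrightarrow> card (F i) \<le> 1"
      "\<And>i. i \<in> I \<Longrightarrow> F i \<noteq> {} \<Longrightarrow> \<beta> j \<le> \<beta> i"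
    using insert.prems(4) by simp_all
  have n_le: "of_bool (a \<in> F j) + n a \<le> x a" if "a \<in> A" for a
    using insert.prems(5)[rule_format, OF that] card_insert_filter[OF insert.hyps(1,2)]
    by (simp add: n_def)
  have n_card: "n a \<le> card I" for a
    unfolding n_def using insert.hyps(1) by (intro card_mono) auto
  have full_avail: "full \<subseteq> avail"
    using n_card by (force simp: full_def avail_def less_Suc_eq_le)
  have F_avail: "F j \<subseteq> avail"
  proof
    fix a assume "a \<in> F j"
    then show "a \<in> avail" using n_le[of a] Fj(1) by (auto simp: avail_def)
  qed
  have full_sum: "sum x full = card full * Suc (card I)" by (simp add: full_def)
  have full_le: "sum x full \<le> sum x A"
    using fin by (intro sum_mono2) (auto simp: full_def)
  \<comment> \<open>Each full row accounts for \<open>Suc (card I)\<close> of the total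
    \<open>\<beta> j + sum \<beta> I\<close>. If \<open>\<beta> j\<close> is maximal, this gives at
    most \<open>\<beta> j\<close> full rows; in case of equality all other rows are zero and
    \<open>F j\<close> lies in \<open>full\<close>, otherwise one place is free for
    \<open>F j\<close>. If \<open>\<beta> j\<close> is not maximal, \<open>F j\<close> is empty and
    the total is still below \<open>(\<beta> j + 1) * Suc (card I)\<close>.\<close>
  have lower: "card (full \<union> F j) \<le> \<beta> j"
  proof (cases "\<forall>i\<in>I. \<beta> i \<le> \<beta> j")
    case True
    then have "sum \<beta> I \<le> card I * \<beta> j" using sum_bounded_above[of I \<beta> "\<beta> j"] by simp
    then have A_le: "sum x A \<le> \<beta> j * Suc (card I)" using sum_x by (simp add: mult.commute)
    then have "card full * Suc (card I) \<le> \<beta> j * Suc (card I)"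
      using full_sum full_le by linarith
    then have le: "card full \<le> \<beta> j" by (simp only: mult_le_cancel2 zero_less_Suc simp_thms)
    show ?thesis
    proof (cases "card full = \<beta> j")
      case True
      then have "sum x A = sum x full" using A_le full_sum full_le by simp
      moreover have "sum x A = sum x full + sum x (A - full)"
        using fin sum.subset_diff[of full A x] by (auto simp: full_def)
      ultimately have "sum x (A - full) = 0" by simp
      then have "\<forall>a\<in>A - full. x a = 0" using fin by simp
      then have "a \<in> full" if "a \<in> avail" for a
        using that by (force simp: avail_def)
      then have "F j \<subseteq> full" using F_avail by blast
      then show ?thesis using True by (simp add: Un_absorb2)
    next
      case False
      then show ?thesis using le card_Un_le[of full "F j"] Fj(2) by linarith
    qed
  next
    case False
    then have "F j = {}" using Fj(3) by blast
    moreover have "sum \<beta> I \<le> card I * (\<beta> j + 1)"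
      using sum_bounded_above[of I \<beta> "\<beta> j + 1"] bal(1) by simp
    then have "card full * Suc (card I) < (\<beta> j + 1) * Suc (card I)"
      using full_sum full_le sum_x by (simp add: algebra_simps)
    then have "card full < \<beta> j + 1" by (simp only: mult_less_cancel2)
    ultimately show ?thesis by simp
  qed
  \<comment> \<open>Suppose at most \<open>m = \<beta> j - 1\<close> rows are available. They hold
    at most \<open>m * Suc (card I)\<close> entries, and all other rows hold reserved ones only. But
    a column has sum at least \<open>m\<close>, and at least \<open>m + 1\<close> if it has a preset
    entry, so with column \<open>j\<close> the total is larger by one.\<close>
  have upper: "\<beta> j \<le> card avail"
  proof (rule ccontr)
    assume "\<not> \<beta> j \<le> card avail"
    then obtain m where m: "\<beta> j = Suc m" "card avail \<le> m" by (cases "\<beta> j") auto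
    have "sum x A = sum x avail + sum x (A - avail)"
      using fin sum.subset_diff[of avail A x] by (auto simp: avail_def)
    also have "sum x avail \<le> card avail * Suc (card I)"
      using sum_bounded_above[of avail x "Suc (card I)"] x_le by (simp add: avail_def)
    also have "card avail * Suc (card I) \<le> m * Suc (card I)" using m(2) by (rule mult_right_mono) simp
    also have "sum x (A - avail) \<le> sum n (A - avail)"
      by (rule sum_mono) (auto simp: avail_def)
    also have "sum n (A - avail) \<le> sum n A" using fin by (intro sum_mono2) auto
    also have "sum n A = (\<Sum>i\<in>I. card (F i))"
      unfolding n_def using fin F(1) by (intro sum_card_fibers) auto
    finally have 1: "sum x A \<le> m * Suc (card I) + (\<Sum>i\<in>I. card (F i))" by simp
    have "(\<Sum>i\<in>I. m + card (F i)) \<le> sum \<beta> I"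
    proof (rule sum_mono)
      fix i assume i: "i \<in> I"
      show "m + card (F i) \<le> \<beta> i"
        using F(2,3)[OF i] bal(2)[OF i] m(1) by (cases "F i = {}") auto
    qed
    then show False using 1 sum_x m(1) by (simp add: sum.distrib mult.commute)
  qed
  obtain D where D: "full \<union> F j \<subseteq> D" "D \<subseteq> avail" "card D = \<beta> j"
    using exists_subset_between[OF lower upper _ fin'(2)] full_avail F_avail by auto
  define y where "y a = x a - of_bool (a \<in> D)" for a
  have xy: "x a = y a + of_bool (a \<in> D)" if "a \<in> A" for a
    using D(2) that by (auto simp: y_def avail_def)
  have DA: "D \<subseteq> A" using D(2) by (auto simp: avail_def)
  have "\<forall>a\<in>A. y a \<le> card I"
  proof
    fix a assume a: "a \<in> A"
    show "y a \<le> card I"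
      using x_le[OF a] D(1) a by (cases "a \<in> full") (auto simp: y_def full_def)
  qed
  moreover have "sum y A = sum \<beta> I"
  proof -
    have "sum x A = (\<Sum>a\<in>A. y a + of_bool (a \<in> D))" by (rule sum.cong) (auto simp: xy)
    also have "\<dots> = sum y A + card D"
      using fin DA by (simp add: sum.distrib Int_absorb1)
    finally show ?thesis using sum_x D(3) by simp
  qed
  moreover have "\<forall>i\<in>I. \<forall>j\<in>I. \<beta> i \<le> \<beta> j + 1"
    "\<forall>i\<in>I. F i \<subseteq> A \<and> card (F i) \<le> 1 \<and> (F i \<noteq> {} \<longrightarrow> (\<forall>j\<in>I. \<beta> j \<le> \<beta> i))"
    using insert.prems(3,4) by simp_all
  moreover have "\<forall>a\<in>A. card {i\<in>I. a \<in> F i} \<le> y a"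
  proof
    fix a assume "a \<in> A"
    then show "card {i\<in>I. a \<in> F i} \<le> y a"
      using n_le[of a] D(2) by (auto simp: y_def avail_def n_def[symmetric])
  qed
  ultimately have "\<exists>C. (\<forall>i\<in>I. F i \<subseteq> C i \<and> C i \<subseteq> A \<and> card (C i) = \<beta> i) \<and>
      (\<forall>a\<in>A. card {i\<in>I. a \<in> C i} = y a)"
    by (rule insert.IH)
  then obtain C where C: "\<forall>i\<in>I. F i \<subseteq> C i \<and> C i \<subseteq> A \<and> card (C i) = \<beta> i"
    "\<forall>a\<in>A. card {i\<in>I. a \<in> C i} = y a"
    by (elim exE conjE) (rule that)
  have upd: "{i\<in>I. a \<in> (C(j := D)) i} = {i\<in>I. a \<in> C i}" for a
    using insert.hyps(2) by auto
  have "\<forall>a\<in>A. card {i\<in>insert j I. a \<in> (C(j := D)) i} = x a"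
    unfolding card_insert_filter[OF insert.hyps(1,2)] upd using C(2) xy by simp
  moreover have "\<forall>i\<in>insert j I. F i \<subseteq> (C(j := D)) i \<and> (C(j := D)) i \<subseteq> A \<and> card ((C(j := D)) i) = \<beta> i"
    using C(1) D DA insert.hyps(2) by auto
  ultimately show ?case by (intro exI[of _ "C(j := D)"] conjI)
qed

context fin_digraph
begin

lemma finite_subset_arcs: "B \<subseteq> arcs G \<Longrightarrow> finite B"
  by (rule finite_subset) auto

lemma sum_by_head:
  fixes x :: "'b \<Rightarrow> nat"
  assumes "B \<subseteq> arcs G" "finite X"
  shows "(\<Sum>v\<in>X. sum x {a\<in>B. head G a = v}) = sum x (arcs_within G B X) + sum x (B \<inter> entering G X)"
proof -
  have "(\<Sum>v\<in>X. sum x {a\<in>B. head G a = v}) = (\<Sum>v\<in>X. sum x {a\<in>{a\<in>B. head G a \<in> X}. head G a = v})"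
    by (intro sum.cong) auto
  also have "\<dots> = sum x {a\<in>B. head G a \<in> X}"
    using assms finite_subset_arcs by (intro sum.group) auto
  also have "{a\<in>B. head G a \<in> X} = arcs_within G B X \<union> (B \<inter> entering G X)"
    using assms by (auto simp: arcs_within_def entering_def)
  also have "sum x \<dots> = sum x (arcs_within G B X) + sum x (B \<inter> entering G X)"
    using assms finite_subset_arcs by (intro sum.union_disjoint) (auto simp: arcs_within_def entering_def)
  finally show ?thesis .
qed

lemma sum_in_degree:
  assumes "B \<subseteq> arcs G" "finite X"
  shows "(\<Sum>v\<in>X. in_degree_of G B v) = card (arcs_within G B X) + card (B \<inter> entering G X)"
  using sum_by_head[OF assms, of "\<lambda>_. 1"] by (simp add: in_degree_of_def)

text \<open>The vertices where class \<open>i\<close> stays below \<open>b\<close> form its root set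
  \<open>R i\<close>. A set meeting \<open>R i\<close> satisfies the sparsity bound by its
  in-degrees alone, and any other is entered by a branching from \<open>R i\<close>, so it suffices
  that \<open>B i\<close> contains one. The remaining arcs only have to produce the right
  in-degrees, which is a separate task at each vertex.\<close>

theorem b_branching_packing:
  fixes b :: "'a \<Rightarrow> nat" and \<beta> :: "'i \<Rightarrow> 'a \<Rightarrow> nat" and x :: "'b \<Rightarrow> nat"
  assumes I: "finite I"
    and x_le: "\<forall>a\<in>arcs G. x a \<le> card I"
    and \<beta>_le: "\<forall>i\<in>I. \<forall>v\<in>verts G. \<beta> i v \<le> b v"
    and balanced: "\<forall>v\<in>verts G. \<forall>i\<in>I. \<forall>j\<in>I. \<beta> i v \<le> \<beta> j v + 1"
    and degree: "\<forall>v\<in>verts G. sum x {a\<in>arcs G. head G a = v} = (\<Sum>i\<in>I. \<beta> i v)"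
    and cut: "\<forall>X\<subseteq>verts G. X \<noteq> {} \<longrightarrow> card {i\<in>I. \<forall>v\<in>X. \<beta> i v = b v} \<le> sum x (entering G X)"
  shows "\<exists>B. (\<forall>i\<in>I. b_branching G (\<lambda>v. int (b v)) (B i) \<and>
        (\<forall>v\<in>verts G. in_degree_of G (B i) v = \<beta> i v)) \<and>
      (\<forall>a\<in>arcs G. card {i\<in>I. a \<in> B i} = x a)"
proof -
  define R where "R i = {v\<in>verts G. \<beta> i v < b v}" for i
  have "{i\<in>I. R i \<inter> X = {}} = {i\<in>I. \<forall>v\<in>X. \<beta> i v = b v}" if "X \<subseteq> verts G" for X
    using \<beta>_le that by (fastforce simp: R_def)
  then have "\<forall>X\<subseteq>verts G. X \<noteq> {} \<longrightarrow> card {i\<in>I. R i \<inter> X = {}} \<le> sum x (entering G X)"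
    using cut by simp
  moreover have "\<forall>i\<in>I. R i \<subseteq> verts G" by (auto simp: R_def)
  ultimately have "\<exists>T. (\<forall>i\<in>I. spanning_branching G (R i) (T i)) \<and>
      (\<forall>a\<in>arcs G. card {i\<in>I. a \<in> T i} \<le> x a)"
    by (intro branching_packing[OF I])
  then obtain T where T: "\<forall>i\<in>I. spanning_branching G (R i) (T i)"
    and T_le: "\<forall>a\<in>arcs G. card {i\<in>I. a \<in> T i} \<le> x a"
    by (elim exE conjE) (rule that)
  \<comment> \<open>At \<open>v\<close> the rows are the arcs into \<open>v\<close> and the columns
    are the classes. An entry is preset only if \<open>v\<close> is not a root of that class, that
    is, if \<open>\<beta> i v = b v\<close>, the largest possible column sum.\<close>
  define P where "P v C \<longleftrightarrow> (\<forall>i\<in>I. {a\<in>T i. head G a = v} \<subseteq> C i \<and> C i \<subseteq> {a\<in>arcs G. head G a = v} \<and> card (C i) = \<beta> i v) \<and>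
      (\<forall>a\<in>{a\<in>arcs G. head G a = v}. card {i\<in>I. a \<in> C i} = x a)" for v C
  have "\<exists>C. P v C" if v: "v \<in> verts G" for v
    unfolding P_def
  proof (rule balanced_assignment[OF I])
    show "finite {a\<in>arcs G. head G a = v}" by simp
    show "\<forall>a\<in>{a\<in>arcs G. head G a = v}. x a \<le> card I" using x_le by simp
    show "sum x {a\<in>arcs G. head G a = v} = (\<Sum>i\<in>I. \<beta> i v)" using degree v by simp
    show "\<forall>i\<in>I. \<forall>j\<in>I. \<beta> i v \<le> \<beta> j v + 1" using balanced v by simp
    show "\<forall>a\<in>{a\<in>arcs G. head G a = v}. card {i\<in>I. a \<in> {a\<in>T i. head G a = v}} \<le> x a"
      using T_le by simp
    show "\<forall>i\<in>I. {a\<in>T i. head G a = v} \<subseteq> {a\<in>arcs G. head G a = v} \<and> card {a\<in>T i. head G a = v} \<le> 1 \<and>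
        ({a\<in>T i. head G a = v} \<noteq> {} \<longrightarrow> (\<forall>j\<in>I. \<beta> j v \<le> \<beta> i v))"
    proof (intro ballI conjI impI)
      fix i assume i: "i \<in> I"
      then have Ti: "T i \<subseteq> arcs G" "inj_on (head G) (T i)" "head G ` T i = verts G - R i"
        using T by (auto simp: spanning_branching_def)
      then show "{a\<in>T i. head G a = v} \<subseteq> {a\<in>arcs G. head G a = v}" by auto
      show "card {a\<in>T i. head G a = v} \<le> 1"
        using Ti(1,2) finite_subset_arcs[of "T i"] by (auto simp: card_le_Suc0_iff_eq inj_on_def)
      assume "{a\<in>T i. head G a = v} \<noteq> {}"
      then have "v \<notin> R i" using Ti(3) by auto
      then have "\<beta> i v = b v" using v i \<beta>_le by (fastforce simp: R_def)
      then show "\<beta> j v \<le> \<beta> i v" if "j \<in> I" for j using \<beta>_le v that by simp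
    qed
  qed
  then have "\<forall>v\<in>verts G. \<exists>C. P v C" by (rule ballI)
  from bchoice[OF this] obtain C where PC: "\<forall>v\<in>verts G. P v (C v)" ..
  have C: "{a\<in>T i. head G a = v} \<subseteq> C v i" "C v i \<subseteq> {a\<in>arcs G. head G a = v}" "card (C v i) = \<beta> i v"
    if "v \<in> verts G" "i \<in> I" for v i
    using PC[rule_format, OF that(1)] that(2) by (simp_all add: P_def)
  have C_card: "card {i\<in>I. a \<in> C (head G a) i} = x a" if "a \<in> arcs G" for a
    using PC[rule_format, OF head_in_verts[OF that]] that by (simp add: P_def)
  define B where "B i = {a\<in>arcs G. a \<in> C (head G a) i}" for i
  have B_arcs: "B i \<subseteq> arcs G" for i by (auto simp: B_def)
  have deg: "in_degree_of G (B i) v = \<beta> i v" if "i \<in> I" "v \<in> verts G" for i v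
  proof -
    have "{a\<in>B i. head G a = v} = C v i" using C(2)[OF that(2,1)] by (auto simp: B_def)
    then show ?thesis using C(3)[OF that(2,1)] by (simp add: in_degree_of_def)
  qed
  have TB: "T i \<subseteq> B i" if "i \<in> I" for i
  proof
    fix a assume a: "a \<in> T i"
    then have "a \<in> arcs G" using T that by (auto simp: spanning_branching_def)
    then show "a \<in> B i" using C(1)[of "head G a" i] that a by (auto simp: B_def)
  qed
  have within: "card (arcs_within G (B i) X) < (\<Sum>v\<in>X. b v)"
    if i: "i \<in> I" and X: "X \<subseteq> verts G" "X \<noteq> {}" for i X
  proof -
    have finX: "finite X" using X(1) by (rule finite_subset) simp
    have "(\<Sum>v\<in>X. in_degree_of G (B i) v) = (\<Sum>v\<in>X. \<beta> i v)"
      using deg[OF i] X(1) by (intro sum.cong) auto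
    then have eq: "(\<Sum>v\<in>X. \<beta> i v) = card (arcs_within G (B i) X) + card (B i \<inter> entering G X)"
      using sum_in_degree[OF B_arcs finX] by metis
    have le: "(\<Sum>v\<in>X. \<beta> i v) \<le> (\<Sum>v\<in>X. b v)" using \<beta>_le i X by (intro sum_mono) auto
    show ?thesis
    proof (cases "X \<inter> R i = {}")
      case True
      then have "T i \<inter> entering G X \<noteq> {}" using T i X by (auto simp: spanning_branching_def)
      then have "B i \<inter> entering G X \<noteq> {}" using TB[OF i] by auto
      then have "card (B i \<inter> entering G X) > 0" by (simp add: card_gt_0_iff)
      then show ?thesis using eq le by linarith
    next
      case False
      then obtain v where "v \<in> X" "\<beta> i v < b v" by (auto simp: R_def)
      then have "(\<Sum>v\<in>X. \<beta> i v) < (\<Sum>v\<in>X. b v)"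
        using \<beta>_le i X finX by (intro sum_strict_mono_ex1) auto
      then show ?thesis using eq by linarith
    qed
  qed
  have "b_branching G (\<lambda>v. int (b v)) (B i)" if i: "i \<in> I" for i
    unfolding b_branching_def
  proof (intro conjI ballI allI impI)
    show "B i \<subseteq> arcs G" by (rule B_arcs)
    show "int (in_degree_of G (B i) v) \<le> int (b v)" if "v \<in> verts G" for v
      using deg[OF i that] \<beta>_le i that by simp
    fix X assume "X \<subseteq> verts G \<and> X \<noteq> {}"
    then have "int (card (arcs_within G (B i) X)) < int (\<Sum>v\<in>X. b v)"
      using within[OF i, of X] by (simp only: of_nat_less_iff simp_thms)
    then show "int (card (arcs_within G (B i) X)) \<le> (\<Sum>v\<in>X. int (b v)) - 1" by simp
  qed
  moreover have "card {i\<in>I. a \<in> B i} = x a" if "a \<in> arcs G" for a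
    using C_card[OF that] that by (simp add: B_def)
  ultimately show ?thesis using deg by (intro exI[of _ B]) simp
qed

end

section \<open>Decomposition into b-branchings of arbitrary sizes\<close>

text \<open>The root arcs into \<open>v\<close> are distinct parallel arcs, not one arc of
  multiplicity \<open>s v\<close>: the packing bounds a multiplicity by the number k of classes,
  while a deficit can reach \<open>k * b v\<close> and one class may need several of these
  arcs.\<close>

definition add_root :: "('v, 'e) pre_digraph \<Rightarrow> ('v \<Rightarrow> nat) \<Rightarrow> ('v option, 'e + 'v \<times> nat) pre_digraph" where
  "add_root G s = \<lparr>verts = insert None (Some ` verts G),
     arcs = Inl ` arcs G \<union> Inr ` (SIGMA v:verts G. {..<s v}),
     tail = case_sum (\<lambda>a. Some (tail G a)) (\<lambda>_. None),
     head = case_sum (\<lambda>a. Some (head G a)) (\<lambda>(v, _). Some v)\<rparr>"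

lemma add_root_simps [simp]:
  "verts (add_root G s) = insert None (Some ` verts G)"
  "arcs (add_root G s) = Inl ` arcs G \<union> Inr ` (SIGMA v:verts G. {..<s v})"
  "tail (add_root G s) (Inl a) = Some (tail G a)"
  "tail (add_root G s) (Inr r) = None"
  "head (add_root G s) (Inl a) = Some (head G a)"
  "head (add_root G s) (Inr r) = Some (fst r)"
  by (auto simp: add_root_def split: prod.splits)

lemma arcs_within_add_root:
  "arcs_within (add_root G s) F (Some ` X) = Inl ` arcs_within G (Inl -` F) X"
proof -
  have "e \<in> arcs_within (add_root G s) F (Some ` X) \<longleftrightarrow> e \<in> Inl ` arcs_within G (Inl -` F) X" for e
    by (cases e) (auto simp: arcs_within_def)
  then show ?thesis by blast
qed

lemma b_branching_sparse:
  assumes "b_branching G b B" "X \<subseteq> verts G" "X \<noteq> {}"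
  shows "int (card (arcs_within G B X)) \<le> (\<Sum>v\<in>X. b v) - 1"
  using assms(1)[unfolded b_branching_def, THEN conjunct2, THEN conjunct2, THEN spec[of _ X]] assms(2,3)
  by simp

context fin_digraph
begin

lemma fin_digraph_add_root: "fin_digraph (add_root G s)"
  by unfold_locales auto

theorem b_branching_decomposition:
  fixes b :: "'a \<Rightarrow> nat" and x :: "'b \<Rightarrow> nat"
  assumes x_le: "\<forall>a\<in>arcs G. x a \<le> k"
    and degree: "\<forall>v\<in>verts G. sum x {a\<in>arcs G. head G a = v} \<le> k * b v"
    and sparse: "\<forall>X\<subseteq>verts G. X \<noteq> {} \<longrightarrow> sum x (arcs_within G (arcs G) X) + k \<le> k * sum b X"
  shows "\<exists>B. (\<forall>i<k. b_branching G (\<lambda>v. int (b v)) (B i)) \<and>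
      (\<forall>a\<in>arcs G. card {i\<in>{..<k}. a \<in> B i} = x a)"
proof -
  define s where "s v = k * b v - sum x {a\<in>arcs G. head G a = v}" for v
  define H where "H = add_root G s"
  define y where "y = case_sum x (\<lambda>_::'a \<times> nat. 1::nat)"
  \<comment> \<open>The value 1 against in-degree 0 makes \<open>None\<close> the only vertex below
    its bound, hence the common root of all classes.\<close>
  define b' where "b' = case_option 1 b"
  define \<beta> where "\<beta> = (\<lambda>_::nat. case_option 0 b)"
  interpret H: fin_digraph H unfolding H_def by (rule fin_digraph_add_root)
  have deg: "sum y {a\<in>arcs H. head H a = Some v} = k * b v" if v: "v \<in> verts G" for v
  proof -
    have "{a\<in>arcs H. head H a = Some v} = Inl ` {a\<in>arcs G. head G a = v} \<union> Inr ` ({v} \<times> {..<s v})"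
      using v by (auto simp: H_def)
    moreover have "sum y (Inl ` {a\<in>arcs G. head G a = v} \<union> Inr ` ({v} \<times> {..<s v}))
        = sum y (Inl ` {a\<in>arcs G. head G a = v}) + sum y (Inr ` ({v} \<times> {..<s v}))"
      by (intro sum.union_disjoint) auto
    moreover have "sum y (Inl ` {a\<in>arcs G. head G a = v}) = sum x {a\<in>arcs G. head G a = v}"
      by (subst sum.reindex) (auto simp: y_def)
    moreover have "sum y (Inr ` ({v} \<times> {..<s v})) = s v"
      by (subst sum.reindex) (auto simp: y_def)
    ultimately show ?thesis using degree v by (simp add: s_def)
  qed
  have deg0: "{a\<in>arcs H. head H a = None} = {}" by (auto simp: H_def)
  have cut: "card {i\<in>{..<k}. \<forall>v\<in>X. \<beta> i v = b' v} \<le> sum y (entering H X)"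
    if X: "X \<subseteq> verts H" "X \<noteq> {}" for X
  proof (cases "None \<in> X")
    case True
    then have "{i\<in>{..<k}. \<forall>v\<in>X. \<beta> i v = b' v} = {}" by (force simp: \<beta>_def b'_def)
    then show ?thesis by (simp only: card.empty le0)
  next
    case False
    define Y where "Y = Some -` X"
    have XY: "X = Some ` Y" using False by (auto simp: Y_def image_iff) (metis option.exhaust)
    have Y: "Y \<subseteq> verts G" "Y \<noteq> {}" using X XY by (auto simp: H_def)
    have finX: "finite X" using X(1) by (rule finite_subset) simp
    \<comment> \<open>The arcs with head in \<open>X\<close> number \<open>k * sum b Y\<close> with
      multiplicity. Root arcs never lie inside \<open>X\<close>, so by \<open>sparse\<close> all but
      at least \<open>k\<close> of this total can lie inside; the rest enters.\<close>
    have "(\<Sum>v\<in>X. sum y {a\<in>arcs H. head H a = v}) = (\<Sum>v\<in>Y. k * b v)"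
      unfolding XY using deg Y(1) by (subst sum.reindex) (auto intro!: sum.cong)
    moreover have "(\<Sum>v\<in>X. sum y {a\<in>arcs H. head H a = v})
        = sum y (arcs_within H (arcs H) X) + sum y (arcs H \<inter> entering H X)"
      by (rule H.sum_by_head) (use finX in auto)
    moreover have "Inl -` arcs H = arcs G" by (auto simp: H_def)
    then have "arcs_within H (arcs H) X = Inl ` arcs_within G (arcs G) Y"
      using arcs_within_add_root[of G s "arcs H" Y] by (simp add: XY H_def)
    then have "sum y (arcs_within H (arcs H) X) = sum x (arcs_within G (arcs G) Y)"
      by (simp add: sum.reindex y_def)
    moreover have "arcs H \<inter> entering H X = entering H X" by (auto simp: entering_def)
    moreover have "sum x (arcs_within G (arcs G) Y) + k \<le> k * sum b Y"
      using sparse Y by simp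
    ultimately have "k \<le> sum y (entering H X)" by (simp add: sum_distrib_left)
    moreover have "card {i\<in>{..<k}. \<forall>v\<in>X. \<beta> i v = b' v} \<le> card {..<k}"
      by (intro card_mono) auto
    ultimately show ?thesis by simp
  qed
  have "\<exists>B. (\<forall>i\<in>{..<k}. b_branching H (\<lambda>v. int (b' v)) (B i) \<and>
        (\<forall>v\<in>verts H. in_degree_of H (B i) v = \<beta> i v)) \<and>
      (\<forall>a\<in>arcs H. card {i\<in>{..<k}. a \<in> B i} = y a)"
  proof (rule H.b_branching_packing)
    \<comment> \<open>A root arc has multiplicity 1, which must not exceed \<open>k\<close>; for
      \<open>k = 0\<close> there are no deficits and so no root arcs.\<close>
    have "k > 0" if "v \<in> verts G" "n < s v" for v n using that by (cases k) (auto simp: s_def)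
    then show "\<forall>a\<in>arcs H. y a \<le> card {..<k}"
      using x_le by (auto simp: y_def H_def Suc_le_eq)
    show "\<forall>i\<in>{..<k}. \<forall>v\<in>verts H. \<beta> i v \<le> b' v"
      by (auto simp: \<beta>_def b'_def split: option.splits)
    show "\<forall>v\<in>verts H. \<forall>i\<in>{..<k}. \<forall>j\<in>{..<k}. \<beta> i v \<le> \<beta> j v + 1"
      by (simp add: \<beta>_def)
    show "\<forall>v\<in>verts H. sum y {a\<in>arcs H. head H a = v} = (\<Sum>i\<in>{..<k}. \<beta> i v)"
    proof
      fix v assume "v \<in> verts H"
      then show "sum y {a\<in>arcs H. head H a = v} = (\<Sum>i\<in>{..<k}. \<beta> i v)"
        using deg deg0 by (cases v) (auto simp: \<beta>_def H_def)
    qed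
    show "\<forall>X\<subseteq>verts H. X \<noteq> {} \<longrightarrow>
        card {i\<in>{..<k}. \<forall>v\<in>X. \<beta> i v = b' v} \<le> sum y (entering H X)"
      using cut by (intro allI impI)
  qed simp
  then obtain B' where B': "\<forall>i\<in>{..<k}. b_branching H (\<lambda>v. int (b' v)) (B' i) \<and>
        (\<forall>v\<in>verts H. in_degree_of H (B' i) v = \<beta> i v)"
      "\<forall>a\<in>arcs H. card {i\<in>{..<k}. a \<in> B' i} = y a"
    by (elim exE conjE) (rule that)
  have "b_branching G (\<lambda>v. int (b v)) (Inl -` B' i)" if i: "i < k" for i
    unfolding b_branching_def
  proof (intro conjI ballI allI impI)
    have br: "b_branching H (\<lambda>v. int (b' v)) (B' i)" using B'(1) i by simp
    then have sub: "B' i \<subseteq> arcs H" by (simp add: b_branching_def)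
    then show "Inl -` B' i \<subseteq> arcs G" by (auto simp: H_def)
    have fin: "finite (B' i)" using sub by (rule H.finite_subset_arcs)
    show "int (in_degree_of G (Inl -` B' i) v) \<le> int (b v)" if v: "v \<in> verts G" for v
    proof -
      have "card {a\<in>Inl -` B' i. head G a = v} = card (Inl ` {a\<in>Inl -` B' i. head G a = v} :: ('b + 'a \<times> nat) set)"
        by (simp add: card_image)
      also have "\<dots> \<le> card {a\<in>B' i. head H a = Some v}"
        using fin by (intro card_mono) (auto simp: H_def)
      also have "\<dots> = b v" using B'(1) i v by (simp add: in_degree_of_def \<beta>_def H_def)
      finally show ?thesis by (simp add: in_degree_of_def)
    qed
    fix X assume X: "X \<subseteq> verts G \<and> X \<noteq> {}"
    then have X': "Some ` X \<subseteq> verts H" "Some ` X \<noteq> {}" by (auto simp: H_def)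
    have "int (card (arcs_within H (B' i) (Some ` X))) \<le> (\<Sum>v\<in>Some ` X. int (b' v)) - 1"
      by (rule b_branching_sparse[OF br X'])
    then show "int (card (arcs_within G (Inl -` B' i) X)) \<le> (\<Sum>v\<in>X. int (b v)) - 1"
      by (simp add: H_def arcs_within_add_root card_image sum.reindex b'_def)
  qed
  moreover have "card {i\<in>{..<k}. a \<in> Inl -` B' i} = x a" if "a \<in> arcs G" for a
    using B'(2)[rule_format, of "Inl a"] that by (simp add: H_def y_def)
  ultimately show ?thesis by (intro exI[of _ "\<lambda>i. Inl -` B' i"]) simp
qed

end

section \<open>Balancing the sizes of two b-branchings\<close>

text \<open>Two elements of one \<open>K\<close> are put on opposite sides. This settles
  \<open>K\<close>, keeps the balance, and does not touch the other members of \<open>\<K>\<close>,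
  which are disjoint from \<open>K\<close>. When no member is left, the rest is halved.\<close>

lemma balanced_splitting:
  fixes A :: "'a set"
  assumes "finite A" "pairwise disjnt \<K>" "\<forall>K\<in>\<K>. K \<subseteq> A \<and> 2 \<le> card K"
  shows "\<exists>P\<subseteq>A. card P \<le> card (A - P) + 1 \<and> card (A - P) \<le> card P + 1 \<and>
    (\<forall>K\<in>\<K>. K \<inter> P \<noteq> {} \<and> K - P \<noteq> {})"
  using assms
proof (induction "card A" arbitrary: A \<K> rule: less_induct)
  case less
  show ?case
  proof (cases "\<K> = {}")
    case True
    obtain P where "P \<subseteq> A" "card P = card A div 2"
      using obtain_subset_with_card_n[of "card A div 2" A] by (metis div_le_dividend)
    moreover then have "card (A - P) = card A - card A div 2"
      using less.prems(1) by (simp add: card_Diff_subset finite_subset)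
    ultimately show ?thesis using True by (intro exI[of _ P]) auto
  next
    case False
    then obtain K where K: "K \<in> \<K>" by auto
    then have KA: "K \<subseteq> A" "2 \<le> card K" using less.prems(3) by auto
    then obtain L where "L \<subseteq> K" "card L = 2"
      using obtain_subset_with_card_n[OF KA(2)] by blast
    then obtain u w where uw: "u \<in> K" "w \<in> K" "u \<noteq> w" by (auto simp: card_2_iff)
    have u: "u \<in> A" and w: "w \<in> A" using uw KA by auto
    let ?A = "A - {u, w}"
    have "card ?A < card A" using less.prems(1) u by (intro psubset_card_mono) auto
    moreover have "finite ?A" using less.prems(1) by simp
    moreover have "pairwise disjnt (\<K> - {K})"
      using less.prems(2) by (rule pairwise_subset) auto
    moreover have "\<forall>K'\<in>\<K> - {K}. K' \<subseteq> ?A \<and> 2 \<le> card K'"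
    proof
      fix K' assume K': "K' \<in> \<K> - {K}"
      then have "disjnt K' K" using less.prems(2) K by (auto simp: pairwise_def)
      then show "K' \<subseteq> ?A \<and> 2 \<le> card K'"
        using less.prems(3) K' uw by (auto simp: disjnt_iff)
    qed
    ultimately have "\<exists>P\<subseteq>?A. card P \<le> card (?A - P) + 1 \<and> card (?A - P) \<le> card P + 1 \<and>
        (\<forall>K\<in>\<K> - {K}. K \<inter> P \<noteq> {} \<and> K - P \<noteq> {})"
      by (rule less.hyps)
    then obtain P where P: "P \<subseteq> ?A" "card P \<le> card (?A - P) + 1" "card (?A - P) \<le> card P + 1"
      "\<forall>K\<in>\<K> - {K}. K \<inter> P \<noteq> {} \<and> K - P \<noteq> {}"
      and disj: "\<forall>K'\<in>\<K> - {K}. K' \<subseteq> ?A"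
      using \<open>\<forall>K'\<in>\<K> - {K}. K' \<subseteq> ?A \<and> 2 \<le> card K'\<close> by auto
    have finP: "finite P" using P(1) less.prems(1) by (simp add: finite_subset)
    have "u \<notin> P" "w \<notin> P" using P(1) by auto
    then have cP: "card (insert u P) = Suc (card P)" using finP by simp
    have "A - insert u P = insert w (?A - P)" using w uw \<open>w \<notin> P\<close> by auto
    then have cA: "card (A - insert u P) = Suc (card (?A - P))" using less.prems(1) by simp
    have "\<forall>K'\<in>\<K>. K' \<inter> insert u P \<noteq> {} \<and> K' - insert u P \<noteq> {}"
    proof
      fix K' assume K': "K' \<in> \<K>"
      show "K' \<inter> insert u P \<noteq> {} \<and> K' - insert u P \<noteq> {}"
      proof (cases "K' = K")
        case True
        then show ?thesis using uw \<open>w \<notin> P\<close> by auto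
      next
        case False
        then have "K' \<inter> P \<noteq> {} \<and> K' - P \<noteq> {}" "u \<notin> K'" using P(4) K' disj by auto
        then show ?thesis by auto
      qed
    qed
    then show ?thesis using P(1-3) cP cA u by (intro exI[of _ "insert u P"]) auto
  qed
qed

context fin_digraph
begin

lemma b_branching_deficit:
  fixes b :: "'a \<Rightarrow> nat"
  assumes B: "b_branching G (\<lambda>v. int (b v)) B" and X: "X \<subseteq> verts G" "X \<noteq> {}"
  shows "(\<Sum>v\<in>X. in_degree_of G B v) + 1 \<le> sum b X + card (B \<inter> entering G X)"
proof -
  have sub: "B \<subseteq> arcs G" using B by (simp add: b_branching_def)
  have finX: "finite X" using X(1) by (rule finite_subset) simp
  have "int (card (arcs_within G B X)) \<le> (\<Sum>v\<in>X. int (b v)) - 1"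
    by (rule b_branching_sparse[OF B X])
  then have "int (card (arcs_within G B X)) + 1 \<le> int (sum b X)" by simp
  then have "card (arcs_within G B X) + 1 \<le> sum b X" by linarith
  then show ?thesis using sum_in_degree[OF sub finX] by linarith
qed

lemma card_eq_sum_in_degree:
  assumes "B \<subseteq> arcs G"
  shows "card B = (\<Sum>v\<in>verts G. in_degree_of G B v)"
proof -
  have "B \<inter> entering G (verts G) = {}" "arcs_within G B (verts G) = B"
    using assms by (auto simp: entering_def arcs_within_def)
  then show ?thesis using sum_in_degree[OF assms finite_verts] by simp
qed

text \<open>The in-degrees are split evenly, with the odd vertices divided so that every minimal set
  that no arc enters contains odd vertices of both kinds; such a set contains two odd vertices as
  soon as it could violate the cut condition.\<close>

theorem b_branching_rebalance:
  fixes b :: "'a \<Rightarrow> nat"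
  assumes B1: "b_branching G (\<lambda>v. int (b v)) B1" and B2: "b_branching G (\<lambda>v. int (b v)) B2"
  shows "\<exists>C1 C2. b_branching G (\<lambda>v. int (b v)) C1 \<and> b_branching G (\<lambda>v. int (b v)) C2 \<and>
    (\<forall>a. of_bool (a \<in> C1) + of_bool (a \<in> C2) = (of_bool (a \<in> B1) + of_bool (a \<in> B2) :: nat)) \<and>
    card C1 \<le> card C2 + 1 \<and> card C2 \<le> card C1 + 1"
proof -
  define x :: "'b \<Rightarrow> nat" where "x a = of_bool (a \<in> B1) + of_bool (a \<in> B2)" for a
  have sub: "B1 \<subseteq> arcs G" "B2 \<subseteq> arcs G" using B1 B2 by (auto simp: b_branching_def)
  have sum_x: "sum x S = card (B1 \<inter> S) + card (B2 \<inter> S)" if "finite S" for S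
    using that by (simp add: x_def sum.distrib Int_commute)
  define d where "d v = in_degree_of G B1 v + in_degree_of G B2 v" for v
  have d: "sum x {a\<in>arcs G. head G a = v} = d v" for v
  proof -
    have "B1 \<inter> {a\<in>arcs G. head G a = v} = {a\<in>B1. head G a = v}"
      "B2 \<inter> {a\<in>arcs G. head G a = v} = {a\<in>B2. head G a = v}" using sub by auto
    then show ?thesis by (simp add: sum_x d_def in_degree_of_def)
  qed
  have d_le: "d v \<le> 2 * b v" if "v \<in> verts G" for v
  proof -
    have "in_degree_of G B1 v \<le> b v" "in_degree_of G B2 v \<le> b v"
      using B1 B2 that by (simp_all add: b_branching_def)
    then show ?thesis by (simp add: d_def)
  qed
  \<comment> \<open>Each of the two b-branchings contributes one unit. The resulting 2 is both the
    demand of a set on which both classes are full and the source of the two odd vertices found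
    below.\<close>
  have deficit: "sum d X + 2 \<le> 2 * sum b X + sum x (entering G X)"
    if "X \<subseteq> verts G" "X \<noteq> {}" for X
    using b_branching_deficit[OF B1 that] b_branching_deficit[OF B2 that]
    by (simp add: d_def sum.distrib sum_x)
  define Q where "Q = {v\<in>verts G. odd (d v)}"
  \<comment> \<open>Only members of \<open>Z\<close> can violate a demand of 1. Being full passes to
    subsets, so the inclusion-minimal members suffice, and submodularity makes these pairwise
    disjoint.\<close>
  define Z where "Z = {X. X \<subseteq> verts G \<and> X \<noteq> {} \<and> sum x (entering G X) = 0}"
  define M where "M = {X\<in>Z. \<forall>Y\<in>Z. Y \<subseteq> X \<longrightarrow> X = Y}"
  \<comment> \<open>By \<open>deficit\<close>, a member of \<open>M\<close> with at most one odd
    vertex is full for neither class, so it needs no splitting.\<close>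
  define \<K> where "\<K> = {X \<inter> Q | X. X \<in> M \<and> 2 \<le> card (X \<inter> Q)}"
  have M_disj: "X = Y" if X: "X \<in> M" and Y: "Y \<in> M" and "X \<inter> Y \<noteq> {}" for X Y
  proof -
    have XZ: "X \<in> Z" "Y \<in> Z" and min: "\<forall>W\<in>Z. W \<subseteq> X \<longrightarrow> X = W" "\<forall>W\<in>Z. W \<subseteq> Y \<longrightarrow> Y = W"
      using X Y by (simp_all add: M_def)
    have "sum x (entering G X) = 0" "sum x (entering G Y) = 0" "X \<subseteq> verts G"
      using XZ by (simp_all add: Z_def)
    moreover then have "sum x (entering G (X \<inter> Y)) = 0"
      using cut_submodular[of x X Y] by linarith
    ultimately have "X \<inter> Y \<in> Z" using \<open>X \<inter> Y \<noteq> {}\<close> unfolding Z_def by (intro CollectI conjI) blast+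
    then have "X = X \<inter> Y" "Y = X \<inter> Y"
      by (rule min[rule_format], simp)+
    then show ?thesis by simp
  qed
  have "\<exists>P\<subseteq>Q. card P \<le> card (Q - P) + 1 \<and> card (Q - P) \<le> card P + 1 \<and>
    (\<forall>K\<in>\<K>. K \<inter> P \<noteq> {} \<and> K - P \<noteq> {})"
  proof (rule balanced_splitting)
    show "finite Q" by (simp add: Q_def)
    show "pairwise disjnt \<K>"
    proof (rule pairwiseI)
      fix K L assume "K \<in> \<K>" "L \<in> \<K>" "K \<noteq> L"
      then obtain X Y where "X \<in> M" "Y \<in> M" "K = X \<inter> Q" "L = Y \<inter> Q" "X \<noteq> Y"
        by (auto simp: \<K>_def)
      then show "disjnt K L" using M_disj[of X Y] by (auto simp: disjnt_def)
    qed
    show "\<forall>K\<in>\<K>. K \<subseteq> Q \<and> 2 \<le> card K" by (auto simp: \<K>_def)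
  qed
  then obtain P where P: "P \<subseteq> Q" "card P \<le> card (Q - P) + 1" "card (Q - P) \<le> card P + 1"
    "\<forall>K\<in>\<K>. K \<inter> P \<noteq> {} \<and> K - P \<noteq> {}"
    by (elim exE conjE) (rule that)
  define \<beta> :: "bool \<Rightarrow> 'a \<Rightarrow> nat" where
    "\<beta> i v = d v div 2 + of_bool (v \<in> (if i then P else Q - P))" for i v
  have \<beta>_sum: "\<beta> True v + \<beta> False v = d v" if "v \<in> verts G" for v
  proof (cases "odd (d v)")
    case True
    then have "v \<in> Q" using that by (simp add: Q_def)
    then show ?thesis using odd_two_times_div_two_succ[OF True] by (simp add: \<beta>_def)
  next
    case False
    then have "v \<notin> Q" "v \<notin> P" using P(1) by (auto simp: Q_def)
    then have "\<beta> True v + \<beta> False v = 2 * (d v div 2)" by (simp add: \<beta>_def)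
    also have "\<dots> = d v" using False by simp
    finally show ?thesis .
  qed
  have \<beta>_le: "\<beta> i v \<le> b v" if "v \<in> verts G" for i v
  proof (cases "odd (d v)")
    case True
    then have "d v div 2 < b v" using d_le[OF that] odd_two_times_div_two_succ[OF True] by linarith
    then show ?thesis by (simp add: \<beta>_def)
  next
    case False
    then have "v \<notin> Q" "v \<notin> P" using P(1) by (auto simp: Q_def)
    then show ?thesis using d_le[OF that] by (simp add: \<beta>_def)
  qed
  have cut: "card {i\<in>UNIV. \<forall>v\<in>X. \<beta> i v = b v} \<le> sum x (entering G X)"
    if X: "X \<subseteq> verts G" "X \<noteq> {}" for X
  proof -
    define full where "full i \<longleftrightarrow> (\<forall>v\<in>X. \<beta> i v = b v)" for i
    have "card {i. full i} \<le> sum x (entering G X)"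
    proof (cases "full True \<and> full False")
      case True
      then have "sum d X = 2 * sum b X"
        unfolding sum_distrib_left using \<beta>_sum X(1)
        by (intro sum.cong) (fastforce simp: full_def)+
      then have "2 \<le> sum x (entering G X)" using deficit[OF X] by linarith
      moreover have "card {i. full i} \<le> card (UNIV :: bool set)" by (rule card_mono) auto
      ultimately show ?thesis by simp
    next
      case False
      then obtain j where "\<not> full j" by blast
      have "i = (\<not> j)" if "full i" for i
        using that \<open>\<not> full j\<close> by (cases i; cases j) simp_all
      then have "{i. full i} \<subseteq> {\<not> j}" by blast
      then have card_le: "card {i. full i} \<le> 1"
        using card_mono[of "{\<not> j}" "{i. full i}"] by simp
      show ?thesis
      proof (cases "sum x (entering G X) = 0")
        case True
        have "\<not> full i" for i
        proof
          assume i: "full i"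
          have "finite {Y\<in>Z. Y \<subseteq> X}"
            by (rule finite_subset[of _ "Pow (verts G)"]) (auto simp: Z_def)
          moreover have "X \<in> {Y\<in>Z. Y \<subseteq> X}" using X True by (simp add: Z_def)
          ultimately have "\<exists>Y\<in>{Y\<in>Z. Y \<subseteq> X}. Y \<subseteq> X \<and> (\<forall>W\<in>{Y\<in>Z. Y \<subseteq> X}. W \<subseteq> Y \<longrightarrow> Y = W)"
            by (rule finite_has_minimal2)
          then obtain Y where YZ: "Y \<in> {Y\<in>Z. Y \<subseteq> X}" and
            min: "\<forall>W\<in>{Y\<in>Z. Y \<subseteq> X}. W \<subseteq> Y \<longrightarrow> Y = W"
            by (elim bexE conjE) (rule that)
          then have Y: "Y \<in> Z" "Y \<subseteq> X" by simp_all
          have YM: "Y \<in> M"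
            unfolding M_def
          proof (intro CollectI conjI ballI impI)
            fix W assume "W \<in> Z" "W \<subseteq> Y"
            then show "Y = W" using min Y(2) by (intro min[rule_format]) auto
          qed (rule Y(1))
          have YV: "Y \<subseteq> verts G" "Y \<noteq> {}" and Y0: "sum x (entering G Y) = 0"
            using Y(1) by (auto simp: Z_def)
          have finY: "finite Y" using YV(1) by (rule finite_subset) simp
          have fullY: "\<beta> i v = b v" if "v \<in> Y" for v using i Y(2) that by (auto simp: full_def)
          \<comment> \<open>Where class \<open>i\<close> is full, \<open>2 * b v\<close> exceeds
            \<open>d v\<close> by at most the rounding. Summed over \<open>Y\<close>, which no arc
            enters, and compared with \<open>deficit\<close>, this yields two odd vertices in
            \<open>Y\<close>. So \<open>P\<close> splits \<open>Y \<inter> Q\<close>, and the odd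
            vertex rounded down for \<open>i\<close> is not full after all.\<close>
          have "2 * b v \<le> d v + of_bool (v \<in> Q)" if v: "v \<in> Y" for v
          proof -
            have "v \<in> Q \<longleftrightarrow> odd (d v)" using v YV(1) by (auto simp: Q_def)
            then have "2 * (d v div 2) + of_bool (v \<in> Q) = d v"
              by (cases "odd (d v)") simp_all
            moreover have "b v \<le> d v div 2 + of_bool (v \<in> Q)"
              unfolding fullY[OF v, symmetric] \<beta>_def using P(1) by (cases i) auto
            ultimately show ?thesis by linarith
          qed
          then have "(\<Sum>v\<in>Y. 2 * b v) \<le> (\<Sum>v\<in>Y. d v + of_bool (v \<in> Q))" by (rule sum_mono)
          also have "\<dots> = sum d Y + card (Y \<inter> Q)" using finY by (simp add: sum.distrib)
          finally have "2 * sum b Y \<le> sum d Y + card (Y \<inter> Q)" by (simp add: sum_distrib_left)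
          then have "2 \<le> card (Y \<inter> Q)" using deficit[OF YV] Y0 by linarith
          then have "Y \<inter> Q \<in> \<K>" using YM by (auto simp: \<K>_def)
          then obtain u w where u: "u \<in> Y \<inter> Q" "u \<in> P" and w: "w \<in> Y \<inter> Q" "w \<notin> P"
            using P(4) by blast
          have strict: "d v div 2 < b v" if "v \<in> Y \<inter> Q" for v
          proof -
            have "v \<in> verts G" "odd (d v)" using that by (auto simp: Q_def)
            then show ?thesis using d_le[of v] odd_two_times_div_two_succ[of "d v"] by linarith
          qed
          show False
          proof (cases i)
            case True
            then show False using fullY[of w] strict[OF w(1)] w by (simp add: \<beta>_def)
          next
            case False
            then show False using fullY[of u] strict[OF u(1)] u by (simp add: \<beta>_def)
          qed
        qed
        then show ?thesis by simp
      next
        case False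
        then show ?thesis using card_le by linarith
      qed
    qed
    then show ?thesis by (simp add: full_def)
  qed
  have "\<exists>B. (\<forall>i\<in>UNIV. b_branching G (\<lambda>v. int (b v)) (B i) \<and>
        (\<forall>v\<in>verts G. in_degree_of G (B i) v = \<beta> i v)) \<and>
      (\<forall>a\<in>arcs G. card {i\<in>UNIV. a \<in> B i} = x a)"
  proof (rule b_branching_packing)
    show "\<forall>a\<in>arcs G. x a \<le> card (UNIV :: bool set)" by (simp add: x_def)
    show "\<forall>i\<in>UNIV. \<forall>v\<in>verts G. \<beta> i v \<le> b v" using \<beta>_le by simp
    show "\<forall>v\<in>verts G. \<forall>i\<in>UNIV. \<forall>j\<in>UNIV. \<beta> i v \<le> \<beta> j v + 1" by (simp add: \<beta>_def)
    show "\<forall>v\<in>verts G. sum x {a\<in>arcs G. head G a = v} = (\<Sum>i\<in>UNIV. \<beta> i v)"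
      using \<beta>_sum d by (simp add: UNIV_bool add.commute)
    show "\<forall>X\<subseteq>verts G. X \<noteq> {} \<longrightarrow> card {i\<in>UNIV. \<forall>v\<in>X. \<beta> i v = b v} \<le> sum x (entering G X)"
      using cut by (intro allI impI)
  qed simp
  then obtain C where C: "\<forall>i\<in>UNIV. b_branching G (\<lambda>v. int (b v)) (C i) \<and>
        (\<forall>v\<in>verts G. in_degree_of G (C i) v = \<beta> i v)"
      "\<forall>a\<in>arcs G. card {i\<in>UNIV. a \<in> C i} = x a"
    by (elim exE conjE) (rule that)
  have C_sub: "C i \<subseteq> arcs G" for i using C(1) by (simp add: b_branching_def)
  have finQ: "finite Q" by (simp add: Q_def)
  have card_C: "card (C i) = (\<Sum>v\<in>verts G. d v div 2) + card (if i then P else Q - P)" for i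
  proof -
    have "(if i then P else Q - P) \<subseteq> verts G" using P(1) by (auto simp: Q_def)
    then have "(\<Sum>v\<in>verts G. \<beta> i v) = (\<Sum>v\<in>verts G. d v div 2) + card (if i then P else Q - P)"
      unfolding \<beta>_def sum.distrib by (simp add: Int_absorb1)
    then show ?thesis using card_eq_sum_in_degree[OF C_sub] C(1) by simp
  qed
  have "of_bool (a \<in> C True) + of_bool (a \<in> C False) = (of_bool (a \<in> B1) + of_bool (a \<in> B2) :: nat)" for a
  proof (cases "a \<in> arcs G")
    case True
    have "card {i\<in>UNIV. a \<in> C i} = (\<Sum>i\<in>UNIV. of_bool (a \<in> C i))" by simp
    then show ?thesis using C(2) True by (simp add: UNIV_bool x_def add.commute)
  next
    case False
    then show ?thesis using C_sub sub by (simp add: subset_iff) blast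
  qed
  then show ?thesis
    using C(1) card_C P(2,3) by (intro exI[of _ "C True"] exI[of _ "C False"]) simp
qed

end

section \<open>Decomposition into b-branchings of equal size\<close>

text \<open>Serves with \<open>f\<close> an indicator, to see that the multiplicities survive an
  exchange of two classes, and with \<open>f\<close> the squared size, to see that the objective
  drops. The additive form avoids truncated subtraction.\<close>

lemma sum_two_updates:
  fixes f :: "'c \<Rightarrow> nat"
  assumes "finite I" "i \<in> I" "j \<in> I" "i \<noteq> j"
  shows "(\<Sum>t\<in>I. f ((B(i := C, j := D)) t)) + f (B i) + f (B j) = (\<Sum>t\<in>I. f (B t)) + f C + f D"
proof -
  have I: "I = insert i (insert j (I - {i, j}))" using assms by auto
  have "(\<Sum>t\<in>I - {i, j}. f ((B(i := C, j := D)) t)) = (\<Sum>t\<in>I - {i, j}. f (B t))"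
    by (rule sum.cong) auto
  then show ?thesis using assms by (subst (1 2) I) simp
qed

lemma sum_squares_balanced_less:
  fixes p q r s :: nat
  assumes "p + q = r + s" "p \<le> q + 1" "q \<le> p + 1" "s + 2 \<le> r"
  shows "p\<^sup>2 + q\<^sup>2 < r\<^sup>2 + s\<^sup>2"
  using assms
proof (induction p q rule: linorder_wlog)
  case (le p q)
  \<comment> \<open>With \<open>p \<le> q\<close>, the fixed sum leaves two cases according to the
    parity of \<open>r - s\<close>; the squares then differ by \<open>2 * m * m\<close> or
    \<open>2 * m * (m + 1)\<close>.\<close>
  define m where "m = p - s"
  have m: "p = s + m" "m > 0" using le by (auto simp: m_def)
  then consider "q = s + m" "r = s + 2 * m" | "q = s + m + 1" "r = s + 2 * m + 1"
    using le by linarith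
  then show ?case
    using m by cases (simp_all add: power2_eq_square algebra_simps)
next
  case (sym p q)
  then show ?case by (simp add: add.commute)
qed

context fin_digraph
begin

lemma card_eq_sum_of_bool: "B \<subseteq> arcs G \<Longrightarrow> card B = (\<Sum>a\<in>arcs G. of_bool (a \<in> B))"
  by (simp add: Int_absorb1)

theorem b_branching_decomposition_equal_size:
  fixes b :: "'a \<Rightarrow> nat" and x :: "'b \<Rightarrow> nat"
  assumes x_le: "\<forall>a\<in>arcs G. x a \<le> k"
    and degree: "\<forall>v\<in>verts G. sum x {a\<in>arcs G. head G a = v} \<le> k * b v"
    and sparse: "\<forall>X\<subseteq>verts G. X \<noteq> {} \<longrightarrow> sum x (arcs_within G (arcs G) X) + k \<le> k * sum b X"
    and total: "sum x (arcs G) = k * l"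
  shows "\<exists>B. (\<forall>i<k. b_branching G (\<lambda>v. int (b v)) (B i) \<and> card (B i) = l) \<and>
      (\<forall>a\<in>arcs G. card {i\<in>{..<k}. a \<in> B i} = x a)"
proof -
  define br where "br = b_branching G (\<lambda>v. int (b v))"
  define dec where "dec B \<longleftrightarrow> (\<forall>i<k. br (B i)) \<and> (\<forall>a\<in>arcs G. (\<Sum>i<k. of_bool (a \<in> B i)) = x a)" for B
  have dec_iff: "dec B \<longleftrightarrow> (\<forall>i<k. br (B i)) \<and> (\<forall>a\<in>arcs G. card {i\<in>{..<k}. a \<in> B i} = x a)" for B
    by (simp add: dec_def Int_def)
  have "\<exists>B. dec B"
    unfolding dec_iff br_def by (rule b_branching_decomposition[OF x_le degree sparse])
  then obtain B where B: "dec B"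
    and min: "\<forall>B'. dec B' \<longrightarrow> (\<Sum>i<k. (card (B i))\<^sup>2) \<le> (\<Sum>i<k. (card (B' i))\<^sup>2)"
    using ex_has_least_nat[of dec _ "\<lambda>B. \<Sum>i<k. (card (B i))\<^sup>2"] by blast
  have br_sub: "S \<subseteq> arcs G" if "br S" for S using that by (simp add: br_def b_branching_def)
  have balanced: "card (B i) \<le> card (B j) + 1" if i: "i < k" and j: "j < k" for i j
  proof (rule ccontr)
    assume "\<not> ?thesis"
    then have gt: "card (B j) + 2 \<le> card (B i)" by simp
    then have "i \<noteq> j" by auto
    have Bij: "br (B i)" "br (B j)" using B i j by (simp_all add: dec_def)
    obtain C D where CD: "br C" "br D"
      "\<forall>a. of_bool (a \<in> C) + of_bool (a \<in> D) = (of_bool (a \<in> B i) + of_bool (a \<in> B j) :: nat)"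
      "card C \<le> card D + 1" "card D \<le> card C + 1"
      using b_branching_rebalance[OF Bij[unfolded br_def], folded br_def] by (elim exE conjE) (rule that)
    define B' where "B' = B(i := C, j := D)"
    note upd = sum_two_updates[of "{..<k}" i j _ B C D, folded B'_def, simplified, OF i j \<open>i \<noteq> j\<close>]
    have "(\<Sum>t<k. of_bool (a \<in> B' t)) = x a" if "a \<in> arcs G" for a
      using upd[of "\<lambda>S. of_bool (a \<in> S)"] CD(3)[rule_format, of a] B that
      unfolding dec_def by (metis (no_types, lifting) add_right_cancel add.assoc)
    moreover have "br (B' t)" if "t < k" for t
      using B CD(1,2) that by (auto simp: B'_def dec_def)
    ultimately have "dec B'" by (simp only: dec_def) blast
    moreover have "card C + card D = card (B i) + card (B j)"
      unfolding card_eq_sum_of_bool[OF br_sub[OF CD(1)]] card_eq_sum_of_bool[OF br_sub[OF CD(2)]]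
        card_eq_sum_of_bool[OF br_sub[OF Bij(1)]] card_eq_sum_of_bool[OF br_sub[OF Bij(2)]]
        sum.distrib[symmetric]
      by (rule sum.cong) (simp_all only: CD(3))
    then have "(card C)\<^sup>2 + (card D)\<^sup>2 < (card (B i))\<^sup>2 + (card (B j))\<^sup>2"
      by (rule sum_squares_balanced_less) (rule CD(4,5) gt)+
    then have "(\<Sum>t<k. (card (B' t))\<^sup>2) < (\<Sum>t<k. (card (B t))\<^sup>2)"
      using upd[of "\<lambda>S. (card S)\<^sup>2"] by linarith
    ultimately show False using min[rule_format, of B'] by simp
  qed
  have "(\<Sum>i<k. card (B i)) = (\<Sum>i<k. \<Sum>a\<in>arcs G. of_bool (a \<in> B i))"
    using B br_sub by (intro sum.cong card_eq_sum_of_bool) (auto simp: dec_def)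
  also have "\<dots> = (\<Sum>a\<in>arcs G. \<Sum>i<k. of_bool (a \<in> B i))" by (rule sum.swap)
  also have "\<dots> = k * l" using B total by (simp add: dec_def)
  finally have sum_card: "(\<Sum>i<k. card (B i)) = (\<Sum>i<k. l)" by simp
  \<comment> \<open>The sizes average \<open>l\<close> and differ pairwise by at most one. A size
    below \<open>l\<close> would keep all others at most \<open>l\<close> and push the total below
    \<open>k * l\<close>; symmetrically for a size above \<open>l\<close>.\<close>
  have "card (B i) = l" if i: "i < k" for i
  proof (rule ccontr)
    assume "card (B i) \<noteq> l"
    then consider "card (B i) < l" | "l < card (B i)" by linarith
    then show False
    proof cases
      case 1
      have "(\<Sum>j<k. card (B j)) < (\<Sum>j<k. l)"
      proof (rule sum_strict_mono_ex1)
        show "\<forall>j\<in>{..<k}. card (B j) \<le> l" using balanced[OF _ i] 1 by fastforce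
        show "\<exists>j\<in>{..<k}. card (B j) < l" using 1 i by auto
      qed simp
      then show False using sum_card by simp
    next
      case 2
      have "(\<Sum>j<k. l) < (\<Sum>j<k. card (B j))"
      proof (rule sum_strict_mono_ex1)
        show "\<forall>j\<in>{..<k}. l \<le> card (B j)" using balanced[OF i] 2 by fastforce
        show "\<exists>j\<in>{..<k}. l < card (B j)" using 2 i by auto
      qed simp
      then show False using sum_card by simp
    qed
  qed
  then show ?thesis using B unfolding dec_iff br_def by (intro exI[of _ B]) simp
qed

end

section \<open>From the convex hull to integer multiplicities and back\<close>

lemma b_branching_cong:
  assumes "\<forall>v\<in>verts G. b v = c v"
  shows "b_branching G b B \<longleftrightarrow> b_branching G c B"
proof -
  have "sum b X = sum c X" if "X \<subseteq> verts G" for X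
    using assms that by (intro sum.cong) auto
  then show ?thesis using assms by (simp add: b_branching_def cong: conj_cong)
qed

lemma sum_incidence_vector: "(\<Sum>a\<in>S. incidence_vector B $ a) = real (card (B \<inter> S))"
  for B S :: "'e::finite set"
proof -
  have "(\<Sum>a\<in>S. incidence_vector B $ a) = (\<Sum>a\<in>S. of_bool (a \<in> B))"
    by (rule sum.cong) (auto simp: incidence_vector_def indicator_def)
  then show ?thesis by (simp add: Int_commute)
qed

text \<open>A coordinate sum is linear, so its values on the hull form the hull of its values on the
  generators. Different choices of \<open>I\<close> give the unit bounds, the degree and sparsity
  bounds, and the size equation.\<close>

lemma sum_in_convex_hull:
  fixes F :: "'e::finite set set"
  assumes p: "p \<in> convex hull {incidence_vector B | B. B \<in> F}" and "convex I"
    and "\<And>B. B \<in> F \<Longrightarrow> real (card (B \<inter> S)) \<in> I"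
  shows "(\<Sum>a\<in>S. p $ a) \<in> I"
proof -
  let ?f = "\<lambda>p::real ^ 'e. \<Sum>a\<in>S. p $ a"
  have "linear ?f" by (intro linearI) (simp_all add: sum.distrib sum_distrib_left)
  then have "?f ` (convex hull {incidence_vector B | B. B \<in> F}) = convex hull (?f ` {incidence_vector B | B. B \<in> F})"
    by (rule convex_hull_linear_image)
  also have "\<dots> \<subseteq> I"
    using assms(2,3) by (intro hull_minimal) (auto simp: sum_incidence_vector)
  finally show ?thesis using p by blast
qed

theorem theorem1p9:
  fixes G :: "('v, 'e::finite) pre_digraph"
    and b :: "'v \<Rightarrow> int"
    and l :: nat
  assumes "fin_digraph G"
    and "\<forall>v\<in>verts G. b v > 0"
  shows "integer_decomposition_property
           (convex hull {incidence_vector B | B. b_branching G b B \<and> card B = l})"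
  unfolding integer_decomposition_property_def
proof (intro allI impI)
  interpret fin_digraph G by fact
  fix k :: nat and x :: "real ^ 'e"
  let ?P = "convex hull {incidence_vector B | B. b_branching G b B \<and> card B = l}"
  assume k: "k > 0" and "integral_vector x \<and> x \<in> (\<lambda>x'. real k *\<^sub>R x') ` ?P"
  then obtain p where int: "\<And>a. x $ a \<in> \<int>" and p: "p \<in> ?P" and x: "x = real k *\<^sub>R p"
    unfolding integral_vector_def by blast
  have xp: "x $ a = real k * p $ a" for a by (simp add: x)
  define F where "F = {B. b_branching G b B \<and> card B = l}"
  have F: "B \<subseteq> arcs G" "card B = l" "b_branching G b B" if "B \<in> F" for B
    using that by (auto simp: F_def b_branching_def)
  have hull: "(\<Sum>a\<in>S. p $ a) \<in> I"
    if "convex I" "\<And>B. B \<in> F \<Longrightarrow> real (card (B \<inter> S)) \<in> I" for S I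
    using p that by (intro sum_in_convex_hull[of p F]) (auto simp: F_def)
  \<comment> \<open>\<open>b\<close> is arbitrary outside \<open>verts G\<close>, so agreement with
    \<open>c\<close> is available only there; \<open>b_branching_cong\<close> bridges the
    gap.\<close>
  define c where "c v = nat (b v)" for v
  have bc: "\<forall>v\<in>verts G. b v = int (c v)" using assms(2) by (auto simp: c_def)
  have sum_bc: "sum b X = int (sum c X)" if "X \<subseteq> verts G" for X
    unfolding of_nat_sum using bc that by (intro sum.cong) auto
  define n where "n a = nat \<lfloor>x $ a\<rfloor>" for a
  have p0: "p $ a \<ge> 0" and p1: "p $ a \<le> 1" for a
  proof -
    have "(\<Sum>a'\<in>{a}. p $ a') \<in> {0..1}"
      by (rule hull) (auto intro: card_mono[of "{a}", simplified])
    then show "p $ a \<ge> 0" "p $ a \<le> 1" by auto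
  qed
  have n: "real (n a) = x $ a" for a
  proof -
    have "x $ a \<ge> 0" using p0[of a] by (simp add: xp)
    then show ?thesis using int[of a] by (auto simp: n_def elim!: Ints_cases)
  qed
  have sum_n: "real (sum n S) = real k * (\<Sum>a\<in>S. p $ a)" for S
    by (simp add: n xp sum_distrib_left)
  have sum_n_le: "sum n S \<le> k * m" if "\<And>B. B \<in> F \<Longrightarrow> card (B \<inter> S) \<le> m" for S m
  proof -
    have "(\<Sum>a\<in>S. p $ a) \<in> {..real m}" using that by (intro hull) auto
    then have "real (sum n S) \<le> real k * real m"
      unfolding sum_n by (intro mult_left_mono) auto
    then show ?thesis by (metis of_nat_le_iff of_nat_mult)
  qed
  have "\<exists>B. (\<forall>i<k. b_branching G (\<lambda>v. int (c v)) (B i) \<and> card (B i) = l) \<and>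
      (\<forall>a\<in>arcs G. card {i\<in>{..<k}. a \<in> B i} = n a)"
  proof (rule b_branching_decomposition_equal_size)
    show "\<forall>a\<in>arcs G. n a \<le> k"
    proof
      fix a
      have "real (n a) \<le> real k" using p1[of a] by (simp add: n xp mult_left_le)
      then show "n a \<le> k" by simp
    qed
    show "\<forall>v\<in>verts G. sum n {a\<in>arcs G. head G a = v} \<le> k * c v"
    proof (intro ballI sum_n_le)
      fix v B assume v: "v \<in> verts G" and B: "B \<in> F"
      have "B \<inter> {a\<in>arcs G. head G a = v} = {a\<in>B. head G a = v}" using F(1)[OF B] by auto
      moreover have "int (card {a\<in>B. head G a = v}) \<le> b v"
        using F(3)[OF B] v by (simp add: b_branching_def in_degree_of_def)
      ultimately show "card (B \<inter> {a\<in>arcs G. head G a = v}) \<le> c v" using bc v by simp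
    qed
    show "\<forall>X\<subseteq>verts G. X \<noteq> {} \<longrightarrow> sum n (arcs_within G (arcs G) X) + k \<le> k * sum c X"
    proof (intro allI impI)
      fix X assume X: "X \<subseteq> verts G" "X \<noteq> {}"
      have fin: "finite X" using X(1) by (rule finite_subset) simp
      have pos: "c v > 0" if "v \<in> X" for v using assms(2) X(1) that by (auto simp: c_def)
      \<comment> \<open>Positivity of \<open>b\<close> keeps the bound \<open>sum c X - 1\<close>
        from being truncated.\<close>
      then have "sum c X > 0" using X(2) fin by (intro sum_pos) auto
      have "sum n (arcs_within G (arcs G) X) \<le> k * (sum c X - 1)"
      proof (rule sum_n_le)
        fix B assume B: "B \<in> F"
        have "B \<inter> arcs_within G (arcs G) X = arcs_within G B X"
          using F(1)[OF B] by (auto simp: arcs_within_def)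
        moreover have "card (arcs_within G B X) \<le> sum c X - 1"
          using b_branching_sparse[OF F(3)[OF B] X] sum_bc[OF X(1)] by linarith
        ultimately show "card (B \<inter> arcs_within G (arcs G) X) \<le> sum c X - 1" by simp
      qed
      moreover have "k * (sum c X - 1) + k = k * sum c X"
        using \<open>sum c X > 0\<close> by (cases "sum c X") auto
      ultimately show "sum n (arcs_within G (arcs G) X) + k \<le> k * sum c X" by linarith
    qed
    \<comment> \<open>All generators have size \<open>l\<close>, so the convex set can be a
      singleton and the total is determined exactly.\<close>
    have "(\<Sum>a\<in>arcs G. p $ a) \<in> {real l}"
      by (rule hull) (use F in \<open>auto simp: Int_absorb2\<close>)
    then have "real (sum n (arcs G)) = real k * real l" unfolding sum_n by simp
    then show "sum n (arcs G) = k * l" by (metis of_nat_eq_iff of_nat_mult)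
  qed
  then obtain B where B: "\<forall>i<k. b_branching G (\<lambda>v. int (c v)) (B i) \<and> card (B i) = l"
    and B_n: "\<forall>a\<in>arcs G. card {i\<in>{..<k}. a \<in> B i} = n a"
    by (elim exE conjE) (rule that)
  have BF: "B i \<in> F" if "i < k" for i
    using B that b_branching_cong[OF bc] by (simp add: F_def)
  have B_n': "card {i\<in>{..<k}. a \<in> B i} = n a" for a
  proof (cases "a \<in> arcs G")
    case False
    \<comment> \<open>No generator contains an element outside the arc set, so the bound is 0 and
      this coordinate of \<open>x\<close> vanishes.\<close>
    have "sum n {a} \<le> k * 0"
    proof (rule sum_n_le)
      fix B assume "B \<in> F"
      then have "B \<inter> {a} = {}" using F(1) False by auto
      then show "card (B \<inter> {a}) \<le> 0" by simp
    qed
    moreover have "{i\<in>{..<k}. a \<in> B i} = {}" using BF F(1) False by blast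
    ultimately show ?thesis by simp
  qed (use B_n in simp)
  show "\<exists>y. (\<forall>i\<in>{1..k}. integral_vector (y i) \<and> y i \<in> ?P) \<and> x = (\<Sum>i=1..k. y i)"
  \<comment> \<open>The classes are numbered from 0, the summands in the definition from 1.\<close>
  proof (intro exI[of _ "\<lambda>i. incidence_vector (B (i - 1))"] conjI ballI)
    fix i assume "i \<in> {1..k}"
    then have i: "i - 1 < k" by auto
    show "integral_vector (incidence_vector (B (i - 1)))"
      by (auto simp: integral_vector_def incidence_vector_def indicator_def)
    show "incidence_vector (B (i - 1)) \<in> ?P"
      using BF[OF i] by (intro hull_inc) (auto simp: F_def)
  next
    have "x $ a = (\<Sum>i=1..k. incidence_vector (B (i - 1))) $ a" for a
    proof -
      have "(\<Sum>i=1..k. incidence_vector (B (i - 1))) $ a = (\<Sum>i<k. incidence_vector (B i) $ a)"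
        unfolding sum_component
        by (rule sum.reindex_bij_witness[of _ Suc "\<lambda>i. i - 1"]) auto
      also have "\<dots> = (\<Sum>i<k. of_bool (a \<in> B i))"
        by (rule sum.cong) (auto simp: incidence_vector_def indicator_def)
      also have "\<dots> = real (card {i\<in>{..<k}. a \<in> B i})" by (simp add: Int_def)
      finally show ?thesis using B_n'[of a] n[of a] by simp
    qed
    then show "x = (\<Sum>i=1..k. incidence_vector (B (i - 1)))" by (simp add: vec_eq_iff)
  qed
qed

end
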